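(* There is an online randomized algorithm for non-metric facility location against a semi-adaptive adversary such that, denoting by $\mathsf{ALG}$ and $\mathsf{OPT}$ the cost of the online algorithm and of the offline optimum (of the instance actually presented) respectively, \[\mathbb{E}[\mathsf{ALG}]\le O(\log|C|\log|F|)\cdot\mathbb{E}[\mathsf{OPT}],\] where $C$ is the set of clients and $F$ the set of facilities of the super-instance fixed by the adversary beforehand, and both expectations are over the random choices of the algorithm. Additionally, denoting by $\operatorname{cost}_{\mathsf{conn}}(\mathsf{ALG})$ the total connection cost incurred by the algorithm, \[\mathbb{E}[\operatorname{cost}_{\mathsf{conn}}(\mathsf{ALG})]\le O(\log|F|)\cdot\mathbb{E}[\mathsf{OPT}].\]
   Context: Online non-metric facility location: there is a complete bipartite graph between clients $C$ and facilities $F$, with facility opening costs $\operatorname{cost}_{\mathsf{fac}}:F\to\mathbb{R}_{\ge0}$ and connection costs $\operatorname{cost}_{\mathsf{conn}}:C\times F\to\mathbb{R}_{\ge0}\cup\{+\infty\}$. At each step a client $c_i$ arrives, together with all facilities $f$ with $\operatorname{cost}_{\mathsf{conn}}(c_i,f)<+\infty$ and their costs; the algorithm must immediately connect $c_i$ to some facility $f$, paying $\operatorname{cost}_{\mathsf{conn}}(c_i,f)$ plus $\operatorname{cost}_{\mathsf{fac}}(f)$ if $f$ was not already open (after which $f$ is open). A semi-adaptive adversary must commit beforehand to a super-instance $(C,F,\operatorname{cost})$, not revealed to the algorithm; in each step it may choose adaptively, based on the algorithm's (random) actions so far, which client of $C$ arrives next, so that the presented instance is a subinstance of the super-instance. The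 algorithm is not given the super-instance in advance. *)

theory Defs
  imports "HOL-Probability.Probability_Mass_Function"
begin

record ('c, 'f) instance_data =
  clients :: "'c set"
  facilities :: "'f set"
  fac_cost :: "'f \<Rightarrow> real"
  conn_cost :: "'c \<Rightarrow> 'f \<Rightarrow> ennreal"

definition super_instance :: "('c, 'f) instance_data \<Rightarrow> bool" where
  "super_instance I \<longleftrightarrow>
     finite (clients I) \<and> finite (facilities I) \<and> (\<forall>f\<in>facilities I. 0 \<le> fac_cost I f)"

text \<open>
  What is revealed when a client arrives: the client together with a partial map whose domain
  consists of the facilities at finite connection cost, each mapped to its opening cost and its
  connection cost to the arriving client.
\<close>

type_synonym ('c, 'f) request = "'c \<times> ('f \<rightharpoonup> real \<times> real)"

definition request :: "('c, 'f) instance_data \<Rightarrow> 'c \<Rightarrow> ('c, 'f) request" where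
  "request I c =
     (c, \<lambda>f. if f \<in> facilities I \<and> conn_cost I c f < \<infinity>
             then Some (fac_cost I f, enn2real (conn_cost I c f)) else None)"

text \<open>
  A transcript lists the arrived clients with the facilities they were connected to, in order of
  arrival.
\<close>

type_synonym ('c, 'f) transcript = "('c \<times> 'f) list"

definition connection_cost :: "('c, 'f) instance_data \<Rightarrow> ('c, 'f) transcript \<Rightarrow> ennreal" where
  "connection_cost I h = (\<Sum>(c, f)\<leftarrow>h. conn_cost I c f)"

text \<open>A facility is paid for once, when a client is first connected to it.\<close>

definition opening_cost :: "('c, 'f) instance_data \<Rightarrow> ('c, 'f) transcript \<Rightarrow> ennreal" where
  "opening_cost I h = (\<Sum>f\<in>snd ` set h. ennreal (fac_cost I f))"

definition total_cost :: "('c, 'f) instance_data \<Rightarrow> ('c, 'f) transcript \<Rightarrow> ennreal" where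
  "total_cost I h = connection_cost I h + opening_cost I h"

text \<open>
  The offline optimum of the subinstance with clients \<open>cs\<close>. It is \<open>\<infinity>\<close> if some client has no
  facility at finite connection cost.
\<close>

definition OPT :: "('c, 'f) instance_data \<Rightarrow> 'c list \<Rightarrow> ennreal" where
  "OPT I cs = (INF g\<in>{g. g ` set cs \<subseteq> facilities I}. total_cost I (map (\<lambda>c. (c, g c)) cs))"

text \<open>
  A randomized online algorithm is given by the conditional distribution of its next choice, given
  the earlier requests with its own choices and the current request. It has no access to the
  super-instance, not even to its size. An algorithm with hidden internal randomness induces
  such conditional distributions. If a request offers no facility, the choice is irrelevant, since
  then the offline optimum is \<open>\<infinity>\<close>.
\<close>

type_synonym ('c, 'f) algorithm =
  "(('c, 'f) request \<times> 'f) list \<Rightarrow> ('c, 'f) request \<Rightarrow> 'f pmf"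

definition online_algorithm :: "('c, 'f) algorithm \<Rightarrow> bool" where
  "online_algorithm A \<longleftrightarrow>
     (\<forall>past r. dom (snd r) \<noteq> {} \<longrightarrow> set_pmf (A past r) \<subseteq> dom (snd r))"

text \<open>
  The adversary picks the next client from the transcript so far, or stops (\<open>None\<close>). The arriving
  clients form a subinstance of the super-instance, so no client arrives twice.
\<close>

type_synonym ('c, 'f) adversary = "('c, 'f) transcript \<Rightarrow> 'c option"

definition semi_adaptive_adversary ::
    "('c, 'f) instance_data \<Rightarrow> ('c, 'f) adversary \<Rightarrow> bool" where
  "semi_adaptive_adversary I adv \<longleftrightarrow>
     (\<forall>h c. adv h = Some c \<longrightarrow> c \<in> clients I \<and> c \<notin> fst ` set h)"

primrec run ::
    "('c, 'f) instance_data \<Rightarrow> ('c, 'f) algorithm \<Rightarrow> ('c, 'f) adversary \<Rightarrow> nat \<Rightarrow>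
     ('c, 'f) transcript \<Rightarrow> ('c, 'f) transcript pmf" where
  "run I A adv 0 h = return_pmf h"
| "run I A adv (Suc n) h =
     (case adv h of
        None \<Rightarrow> return_pmf h
      | Some c \<Rightarrow>
          bind_pmf (A (map (\<lambda>(c', f). (request I c', f)) h) (request I c))
            (\<lambda>f. run I A adv n (h @ [(c, f)])))"

text \<open>
  As no client arrives twice, every interaction is over after at most \<open>card (clients I)\<close> steps.
\<close>

definition play ::
    "('c, 'f) instance_data \<Rightarrow> ('c, 'f) algorithm \<Rightarrow> ('c, 'f) adversary \<Rightarrow>
     ('c, 'f) transcript pmf" where
  "play I A adv = run I A adv (card (clients I)) []"

definition E_ALG ::
    "('c, 'f) instance_data \<Rightarrow> ('c, 'f) algorithm \<Rightarrow> ('c, 'f) adversary \<Rightarrow> ennreal" where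
  "E_ALG I A adv = (\<integral>\<^sup>+ h. total_cost I h \<partial>measure_pmf (play I A adv))"

definition E_conn_ALG ::
    "('c, 'f) instance_data \<Rightarrow> ('c, 'f) algorithm \<Rightarrow> ('c, 'f) adversary \<Rightarrow> ennreal" where
  "E_conn_ALG I A adv = (\<integral>\<^sup>+ h. connection_cost I h \<partial>measure_pmf (play I A adv))"

definition E_OPT ::
    "('c, 'f) instance_data \<Rightarrow> ('c, 'f) algorithm \<Rightarrow> ('c, 'f) adversary \<Rightarrow> ennreal" where
  "E_OPT I A adv = (\<integral>\<^sup>+ h. OPT I (map fst h) \<partial>measure_pmf (play I A adv))"

text \<open>
  The logarithm inside the O-bounds. For \<open>n \<ge> 2\<close> this is just \<open>log 2 n\<close>; the maximum matters only
  for \<open>n \<le> 1\<close>, where a bound with factor \<open>log 2 1 = 0\<close> would be false.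
\<close>

definition log1 :: "nat \<Rightarrow> real" where
  "log1 n = max 1 (log 2 (real n))"

end

theory Submission
  imports Defs "HOL-Probability.Product_PMF"
begin

text \<open>
  When a client \<open>c\<close> arrives, its dual variable \<open>\<tau>\<close> is raised, and each facility \<open>f\<close> with opening
  cost \<open>a f\<close> at distance \<open>d f\<close> grows its fractional opening \<open>y f\<close> exponentially at rate
  \<open>1 / a f\<close> while \<open>d f < \<tau>\<close>, until facilities of total weight \<open>1 / 2\<close> lie within distance \<open>\<tau>\<close>.
  The sum \<open>V\<close> of all dual variables bounds the fractional cost up to a constant, and
  \<open>V \<le> O(log |F|) * OPT\<close> holds on every request sequence.

  The rounding works in phases, during which \<open>V\<close> lies between a power \<open>Z\<close> of two and \<open>2 * Z\<close>.
  The client is connected within a radius \<open>D\<close> obtained by rounding \<open>\<tau>\<close> up to the form \<open>2 * Z / 2 ^ k\<close>,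
  where \<open>k\<close> is at most one plus the number of earlier clients, so that all connections cost at most
  \<open>4 * V\<close> while only \<open>O(|C|\<^sup>2)\<close> balls matter in a phase. If no facility in the ball of \<open>c\<close> is open, each
  facility of the ball is opened independently so that its accumulated hazard in this phase becomes
  \<open>l * y f\<close>. If nothing opens, the cheapest facility of the ball is opened and the rate \<open>l\<close> is
  increased by one. So \<open>l\<close> adapts to the unknown number of clients: for a fixed ball, \<open>exp\<close> of its
  accumulated hazard, counted while all its facilities are closed, is a supermartingale whatever the
  adversary does, and summing over the balls of the super-instance shows that \<open>l\<close> stays \<open>O(log |C|)\<close> in
  expectation, conditionally on the start of the phase. A phase thus costs \<open>O(log |C|) * Z\<close>,
  and the values \<open>Z\<close> of the phases form a geometric sum.

  The openings and the rate are hidden in the transcript, so the algorithm in the required format plays the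
  conditional distribution of the next choice under the posterior of the hidden state.
\<close>

section \<open>Algorithms with hidden state\<close>

text \<open>Disintegration of a joint law. Only values \<open>x\<close> of positive probability are
  drawn, so the conditioning event always meets the support.\<close>

lemma bind_map_cond_pmf:
  fixes q :: "('a \<times> 'b) pmf"
  shows
  "bind_pmf (map_pmf fst q) (\<lambda>x. bind_pmf (map_pmf snd (cond_pmf q {z. fst z = x})) (g x)) =
   bind_pmf q (\<lambda>(x, y). g x y)"
proof -
  have ne: "set_pmf q \<inter> {z. fst z = x} \<noteq> {}" if "x \<in> set_pmf (map_pmf fst q)" for x
    using that by auto
  have q: "bind_pmf (map_pmf fst q) (\<lambda>x. cond_pmf q {z. fst z = x}) = q"
  proof (rule bind_cond_pmf_cancel[where R = "\<lambda>x z. fst z = x"])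
    fix x and y :: "'a \<times> 'b" assume "fst y = x"
    then show "measure_pmf.prob q {z. fst z = x} = measure_pmf.prob (map_pmf fst q) {x. fst y = x}"
      by (simp add: vimage_def eq_commute)
  qed (use ne in auto)
  have "bind_pmf q (\<lambda>(x, y). g x y) =
      bind_pmf (bind_pmf (map_pmf fst q) (\<lambda>x. cond_pmf q {z. fst z = x})) (\<lambda>(x, y). g x y)"
    by (simp only: q)
  also have "\<dots> = bind_pmf (map_pmf fst q)
      (\<lambda>x. bind_pmf (cond_pmf q {z. fst z = x}) (\<lambda>(x, y). g x y))"
    by (simp add: bind_assoc_pmf)
  also have "\<dots> = bind_pmf (map_pmf fst q) (\<lambda>x. bind_pmf (map_pmf snd (cond_pmf q {z. fst z = x})) (g x))"
    by (intro bind_pmf_cong refl) (use set_cond_pmf[OF ne] in \<open>force simp: bind_map_pmf intro!: bind_pmf_cong\<close>)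
  finally show ?thesis by simp
qed

type_synonym ('c, 'f, 's) hidden_step =
  "(('c, 'f) request \<times> 'f) list \<Rightarrow> ('c, 'f) request \<Rightarrow> 's \<Rightarrow> ('f \<times> 's) pmf"

abbreviation past_of ::
    "('c, 'f) instance_data \<Rightarrow> ('c, 'f) transcript \<Rightarrow> (('c, 'f) request \<times> 'f) list" where
  "past_of I h \<equiv> map (\<lambda>(c, f). (request I c, f)) h"

primrec hidden_run ::
    "('c, 'f) instance_data \<Rightarrow> ('c, 'f, 's) hidden_step \<Rightarrow> ('c, 'f) adversary \<Rightarrow> nat \<Rightarrow>
     ('c, 'f) transcript \<Rightarrow> 's \<Rightarrow> ('c, 'f) transcript pmf" where
  "hidden_run I st adv 0 h s = return_pmf h"
| "hidden_run I st adv (Suc n) h s =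
     (case adv h of
        None \<Rightarrow> return_pmf h
      | Some c \<Rightarrow>
          bind_pmf (st (past_of I h) (request I c) s)
            (\<lambda>(f, s'). hidden_run I st adv n (h @ [(c, f)]) s'))"

text \<open>The past is given latest event first.\<close>

primrec posterior_rev ::
    "('c, 'f, 's) hidden_step \<Rightarrow> 's \<Rightarrow> (('c, 'f) request \<times> 'f) list \<Rightarrow> 's pmf" where
  "posterior_rev st s0 [] = return_pmf s0"
| "posterior_rev st s0 (x # xs) =
     map_pmf snd (cond_pmf (bind_pmf (posterior_rev st s0 xs) (st (rev xs) (fst x)))
       {z. fst z = snd x})"

definition posterior ::
    "('c, 'f, 's) hidden_step \<Rightarrow> 's \<Rightarrow> (('c, 'f) request \<times> 'f) list \<Rightarrow> 's pmf" where
  "posterior st s0 past = posterior_rev st s0 (rev past)"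

text \<open>The behaviour strategy of Kuhn's theorem: each round draws a fresh hidden state from the
  posterior and then forgets it.\<close>

definition behavioural :: "('c, 'f, 's) hidden_step \<Rightarrow> 's \<Rightarrow> ('c, 'f) algorithm" where
  "behavioural st s0 past r = map_pmf fst (bind_pmf (posterior st s0 past) (st past r))"

text \<open>The posterior after a choice \<open>f\<close> is by construction the conditional law of
  the new state given \<open>f\<close>, and the adversary sees only the transcript, so resampling
  changes nothing. Starting both sides at the posterior of \<open>h\<close> makes the equation
  inductive for every \<open>h\<close>.\<close>

lemma run_behavioural:
  "run I (behavioural st s0) adv n h =
   bind_pmf (posterior st s0 (past_of I h)) (hidden_run I st adv n h)"
proof (induction n arbitrary: h)
  case 0
  show ?case by simp
next
  case (Suc n)
  show ?case
  proof (cases "adv h")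
    case None
    then show ?thesis by simp
  next
    case (Some c)
    let ?r = "request I c" and ?p = "past_of I h"
    let ?q = "bind_pmf (posterior st s0 ?p) (st ?p ?r)"
    have post: "posterior st s0 (past_of I (h @ [(c, f)])) = map_pmf snd (cond_pmf ?q {z. fst z = f})"
      for f by (simp add: posterior_def)
    have "run I (behavioural st s0) adv (Suc n) h =
        bind_pmf (map_pmf fst ?q) (\<lambda>f. run I (behavioural st s0) adv n (h @ [(c, f)]))"
      by (simp add: Some behavioural_def)
    also have "\<dots> = bind_pmf (map_pmf fst ?q) (\<lambda>f. bind_pmf (map_pmf snd (cond_pmf ?q {z. fst z = f}))
        (hidden_run I st adv n (h @ [(c, f)])))"
      by (simp only: Suc.IH post)
    also have "\<dots> = bind_pmf ?q (\<lambda>(f, s). hidden_run I st adv n (h @ [(c, f)]) s)"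
      by (rule bind_map_cond_pmf)
    also have "\<dots> = bind_pmf (posterior st s0 ?p) (hidden_run I st adv (Suc n) h)"
      unfolding bind_assoc_pmf by (intro bind_pmf_cong refl) (simp add: Some)
    finally show ?thesis .
  qed
qed

lemma play_behavioural:
  "play I (behavioural st s0) adv = hidden_run I st adv (card (clients I)) [] s0"
  by (simp add: play_def run_behavioural posterior_def bind_return_pmf)

lemma online_behavioural:
  assumes "\<And>past r s f s'. dom (snd r) \<noteq> {} \<Longrightarrow> (f, s') \<in> set_pmf (st past r s) \<Longrightarrow> f \<in> dom (snd r)"
  shows "online_algorithm (behavioural st s0)"
  unfolding online_algorithm_def behavioural_def
proof (intro allI impI subsetI)
  fix past and r :: "('a, 'b) request" and f
  assume "dom (snd r) \<noteq> {}"
    and "f \<in> set_pmf (map_pmf fst (bind_pmf (posterior st s0 past) (st past r)))"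
  then obtain s s' where "(f, s') \<in> set_pmf (st past r s)" by auto
  then show "f \<in> dom (snd r)" using assms \<open>dom (snd r) \<noteq> {}\<close> by blast
qed

section \<open>The fractional solution\<close>

definition open_cost :: "('f \<rightharpoonup> real \<times> real) \<Rightarrow> 'f \<Rightarrow> real" where
  "open_cost \<phi> f = fst (the (\<phi> f))"

definition dist_to :: "('f \<rightharpoonup> real \<times> real) \<Rightarrow> 'f \<Rightarrow> real" where
  "dist_to \<phi> f = snd (the (\<phi> f))"

text \<open>The case of zero cost is separate because the exponent is \<open>0\<close> there (division by zero).\<close>

definition grow :: "('f \<rightharpoonup> real \<times> real) \<Rightarrow> ('f \<Rightarrow> real) \<Rightarrow> real \<Rightarrow> 'f \<Rightarrow> real" where
  "grow \<phi> y \<tau> f =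
     (if f \<notin> dom \<phi> then y f
      else if open_cost \<phi> f = 0 then 1
      else (y f + 1 / card (dom \<phi>)) * exp (max 0 (\<tau> - dist_to \<phi> f) / open_cost \<phi> f) - 1 / card (dom \<phi>))"

text \<open>Two inequalities replace an equation because the mass within distance
  \<open>\<tau>\<close> jumps when \<open>\<tau>\<close> reaches facilities that already carry
  weight.\<close>

definition is_dual :: "('f \<rightharpoonup> real \<times> real) \<Rightarrow> ('f \<Rightarrow> real) \<Rightarrow> real \<Rightarrow> bool" where
  "is_dual \<phi> y \<tau> \<longleftrightarrow> 0 \<le> \<tau> \<and>
     (\<Sum>f | f \<in> dom \<phi> \<and> dist_to \<phi> f < \<tau>. grow \<phi> y \<tau> f) \<le> 1 / 2 \<and>
     1 / 2 \<le> (\<Sum>f | f \<in> dom \<phi> \<and> dist_to \<phi> f \<le> \<tau>. grow \<phi> y \<tau> f)"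

section \<open>Growth of a facility and existence of the dual value\<close>

lemma grow_nonneg:
  assumes "finite (dom \<phi>)" "f \<in> dom \<phi> \<Longrightarrow> 0 \<le> open_cost \<phi> f" "0 \<le> y f"
  shows "0 \<le> grow \<phi> y \<tau> f"
proof -
  have "(y f + 1 / card (dom \<phi>)) * 1 \<le> (y f + 1 / card (dom \<phi>)) * exp (max 0 (\<tau> - dist_to \<phi> f) / open_cost \<phi> f)"
    if "f \<in> dom \<phi>"
    using assms that by (intro mult_left_mono) auto
  moreover have "1 / card (dom \<phi>) \<le> y f + 1 / card (dom \<phi>)" using assms by simp
  ultimately show ?thesis using assms unfolding grow_def by (smt (verit) mult_1_right)
qed

lemma continuous_grow: "isCont (\<lambda>\<tau>. grow \<phi> y \<tau> f) \<tau>0"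
proof (cases "f \<in> dom \<phi> \<and> open_cost \<phi> f \<noteq> 0")
  case True
  then have "(\<lambda>\<tau>. grow \<phi> y \<tau> f) = (\<lambda>\<tau>. (y f + 1 / card (dom \<phi>)) *
      exp (max 0 (\<tau> - dist_to \<phi> f) / open_cost \<phi> f) - 1 / card (dom \<phi>))"
    by (auto simp: grow_def)
  then show ?thesis using True by (simp only:) (intro continuous_intros, simp)
next
  case False
  then have "(\<lambda>\<tau>. grow \<phi> y \<tau> f) = (\<lambda>\<tau>. if f \<notin> dom \<phi> then y f else 1)"
    by (auto simp: grow_def)
  then show ?thesis by simp
qed

text \<open>The infimum \<open>t\<close> of the radii whose closed ball has mass at least one half
  works: closed balls make the mass continuous from the right, which gives the lower bound, and an
  excess in the open ball would persist slightly to the left of \<open>t\<close>.\<close>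

lemma ex_is_dual:
  fixes \<phi> :: "'f \<rightharpoonup> real \<times> real"
  assumes fin: "finite (dom \<phi>)" and ne: "dom \<phi> \<noteq> {}"
    and a: "\<And>f. f \<in> dom \<phi> \<Longrightarrow> 0 \<le> open_cost \<phi> f" and d: "\<And>f. f \<in> dom \<phi> \<Longrightarrow> 0 \<le> dist_to \<phi> f"
    and y: "\<And>f. 0 \<le> y f"
  shows "\<exists>\<tau>. is_dual \<phi> y \<tau>"
proof -
  define G where "G \<tau> = (\<Sum>f | f \<in> dom \<phi> \<and> dist_to \<phi> f \<le> \<tau>. grow \<phi> y \<tau> f)" for \<tau>
  define T where "T = {\<tau>. 0 \<le> \<tau> \<and> 1 / 2 \<le> G \<tau>}"
  have g0: "0 \<le> grow \<phi> y \<tau> f" if "f \<in> dom \<phi>" for \<tau> f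
    by (intro grow_nonneg fin a y)
  obtain f where f: "f \<in> dom \<phi>" using ne by blast
  let ?k = "real (card (dom \<phi>))"
  have k: "?k > 0" using fin ne by (simp add: card_gt_0_iff)
  \<comment> \<open>One facility suffices to see that \<open>T\<close> is nonempty: the exponent
    becomes \<open>?k / 2\<close>, and exp x \<ge> 1 + x lifts the offset \<open>1 / ?k\<close> by
    one half.\<close>
  let ?t = "dist_to \<phi> f + open_cost \<phi> f * ?k / 2"
  have "1 / 2 \<le> grow \<phi> y ?t f"
  proof (cases "open_cost \<phi> f = 0")
    case True then show ?thesis using f by (simp add: grow_def)
  next
    case False
    then have "open_cost \<phi> f > 0" using a[OF f] by simp
    then have "max 0 (?t - dist_to \<phi> f) / open_cost \<phi> f = ?k / 2" using k by simp
    then have "grow \<phi> y ?t f = (y f + 1 / ?k) * exp (?k / 2) - 1 / ?k"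
      using f False by (simp add: grow_def)
    moreover have "(1 / ?k) * (1 + ?k / 2) \<le> (y f + 1 / ?k) * exp (?k / 2)"
      using y k by (intro mult_mono) (auto simp: add_nonneg_nonneg)
    moreover have "(1 / ?k) * (1 + ?k / 2) = 1 / ?k + 1 / 2" using k by (simp add: field_simps)
    ultimately show ?thesis by linarith
  qed
  also have "\<dots> \<le> G ?t"
    unfolding G_def using f fin k a[OF f] by (intro member_le_sum) (auto intro: g0)
  finally have T1: "?t \<in> T" using d[OF f] a[OF f] k by (simp add: T_def)
  have bdd: "bdd_below T" by (auto simp: T_def bdd_below_def)
  define t where "t = Inf T"
  have t0: "0 \<le> t" unfolding t_def using T1 by (intro cInf_greatest) (auto simp: T_def)
  have below: "\<tau> \<notin> T" if "\<tau> < t" for \<tau>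
    using that bdd cInf_lower[of \<tau> T] by (auto simp: t_def)
  have "1 / 2 \<le> G t"
  proof (rule ccontr)
    assume neg: "\<not> 1 / 2 \<le> G t"
    let ?A = "{f. f \<in> dom \<phi> \<and> dist_to \<phi> f \<le> t}"
    have "isCont (\<lambda>\<tau>. \<Sum>f\<in>?A. grow \<phi> y \<tau> f) t"
      by (rule isCont_sum) (simp add: continuous_grow)
    then have "((\<lambda>\<tau>. \<Sum>f\<in>?A. grow \<phi> y \<tau> f) \<longlongrightarrow> G t) (at_right t)"
      unfolding isCont_def G_def by (rule filterlim_mono) (auto simp: at_le)
    then have 1: "\<forall>\<^sub>F \<tau> in at_right t. (\<Sum>f\<in>?A. grow \<phi> y \<tau> f) < 1 / 2"
      using neg by (intro order_tendstoD(2)) auto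
    \<comment> \<open>By finiteness no facility enters the closed ball immediately to the right of
      \<open>t\<close>.\<close>
    have 2: "\<forall>\<^sub>F \<tau> in at_right t. \<forall>f\<in>dom \<phi>. t < dist_to \<phi> f \<longrightarrow> \<tau> < dist_to \<phi> f"
      using fin
    proof (intro eventually_ball_finite ballI)
      fix f
      show "\<forall>\<^sub>F \<tau> in at_right t. t < dist_to \<phi> f \<longrightarrow> \<tau> < dist_to \<phi> f"
      proof (cases "t < dist_to \<phi> f")
        case True
        then show ?thesis
          unfolding eventually_at_right_field by (intro exI[of _ "dist_to \<phi> f"]) auto
      qed auto
    qed
    from 1 2 have "\<forall>\<^sub>F \<tau> in at_right t. \<tau> \<notin> T"
    proof eventually_elim
      case (elim \<tau>)
      show ?case
      proof
        assume "\<tau> \<in> T"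
        then have "t \<le> \<tau>" using below by force
        then have "{f. f \<in> dom \<phi> \<and> dist_to \<phi> f \<le> \<tau>} = ?A" using elim(2) by force
        then show False using elim(1) \<open>\<tau> \<in> T\<close> by (simp add: T_def G_def)
      qed
    qed
    then obtain b where b: "b > t" "\<And>\<tau>. t < \<tau> \<Longrightarrow> \<tau> < b \<Longrightarrow> \<tau> \<notin> T"
      by (auto simp: eventually_at_right_field)
    obtain \<tau> where "\<tau> \<in> T" "\<tau> < b"
      using b(1) T1 cInf_lessD[of T b] unfolding t_def by auto
    moreover have "t \<notin> T" using neg by (simp add: T_def)
    ultimately show False using b below[of \<tau>] by (cases "\<tau> = t"; cases "\<tau> < t") auto
  qed
  moreover have "(\<Sum>f | f \<in> dom \<phi> \<and> dist_to \<phi> f < t. grow \<phi> y t f) \<le> 1 / 2"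
  proof (rule ccontr)
    let ?B = "{f. f \<in> dom \<phi> \<and> dist_to \<phi> f < t}"
    assume neg: "\<not> (\<Sum>f\<in>?B. grow \<phi> y t f) \<le> 1 / 2"
    \<comment> \<open>A facility at distance below \<open>t\<close> forces \<open>0 < t\<close>, so
      radii just left of \<open>t\<close> are nonnegative and can lie in \<open>T\<close>.\<close>
    have "?B \<noteq> {}"
    proof
      assume "?B = {}"
      with neg show False by (simp only: sum.empty)
    qed
    then have tpos: "0 < t" using d by force
    have "isCont (\<lambda>\<tau>. \<Sum>f\<in>?B. grow \<phi> y \<tau> f) t"
      by (rule isCont_sum) (simp add: continuous_grow)
    then have "((\<lambda>\<tau>. \<Sum>f\<in>?B. grow \<phi> y \<tau> f) \<longlongrightarrow> (\<Sum>f\<in>?B. grow \<phi> y t f)) (at_left t)"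
      unfolding isCont_def by (rule filterlim_mono) (auto simp: at_le)
    then have 1: "\<forall>\<^sub>F \<tau> in at_left t. 1 / 2 < (\<Sum>f\<in>?B. grow \<phi> y \<tau> f)"
      using neg by (intro order_tendstoD(1)) auto
    have 2: "\<forall>\<^sub>F \<tau> in at_left t. \<forall>f\<in>dom \<phi>. dist_to \<phi> f < t \<longrightarrow> dist_to \<phi> f < \<tau>"
      using fin
    proof (intro eventually_ball_finite ballI)
      fix f
      show "\<forall>\<^sub>F \<tau> in at_left t. dist_to \<phi> f < t \<longrightarrow> dist_to \<phi> f < \<tau>"
      proof (cases "dist_to \<phi> f < t")
        case True
        then show ?thesis
          unfolding eventually_at_left_field by (intro exI[of _ "dist_to \<phi> f"]) auto
      qed auto
    qed
    have 3: "\<forall>\<^sub>F \<tau> in at_left t. 0 < \<tau> \<and> \<tau> < t"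
      using tpos unfolding eventually_at_left_field by blast
    have "\<forall>\<^sub>F \<tau> in at_left t. False"
      using 1 2 3
    proof eventually_elim
      case (elim \<tau>)
      have "(\<Sum>f\<in>?B. grow \<phi> y \<tau> f) \<le> G \<tau>"
        unfolding G_def using elim(2) fin by (intro sum_mono2) (auto intro: g0 less_imp_le)
      then have "\<tau> \<in> T" using elim by (simp add: T_def)
      then show False using below elim(3) by blast
    qed
    then show False by (simp add: trivial_limit_def[symmetric])
  qed
  ultimately show ?thesis using t0 unfolding is_dual_def G_def by blast
qed

lemma grow_mono:
  assumes "finite (dom \<phi>)" "0 \<le> y f" "f \<in> dom \<phi> \<Longrightarrow> 0 \<le> open_cost \<phi> f"
    "f \<in> dom \<phi> \<Longrightarrow> open_cost \<phi> f = 0 \<Longrightarrow> y f \<le> 1"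
  shows "y f \<le> grow \<phi> y \<tau> f"
proof (cases "f \<in> dom \<phi> \<and> open_cost \<phi> f \<noteq> 0")
  case True
  then have "(y f + 1 / card (dom \<phi>)) * 1 \<le>
      (y f + 1 / card (dom \<phi>)) * exp (max 0 (\<tau> - dist_to \<phi> f) / open_cost \<phi> f)"
    using assms by (intro mult_left_mono) auto
  then show ?thesis using True by (simp add: grow_def)
next
  case False
  then show ?thesis using assms by (auto simp: grow_def)
qed

text \<open>Beyond the distance, \<open>grow\<close> solves dy/d\<tau> = (y + 1/k) / a with k
  offered facilities. So cost accrues at rate y + 1/k, which is at most its final value, for a time
  at most \<open>\<tau>\<close>.\<close>

lemma grow_cost_le:
  assumes "f \<in> dom \<phi>" "0 < open_cost \<phi> f" "dist_to \<phi> f < \<tau>" "0 \<le> dist_to \<phi> f" "0 \<le> y f"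
  shows "open_cost \<phi> f * (grow \<phi> y \<tau> f - y f) \<le> \<tau> * (grow \<phi> y \<tau> f + 1 / card (dom \<phi>))"
proof -
  let ?k = "real (card (dom \<phi>))" and ?a = "open_cost \<phi> f" and ?t = "\<tau> - dist_to \<phi> f"
  let ?x = "?t / ?a"
  have g: "grow \<phi> y \<tau> f = (y f + 1 / ?k) * exp ?x - 1 / ?k"
    using assms by (simp add: grow_def)
  have "exp ?x - 1 = exp ?x * (1 - exp (- ?x))" by (simp add: algebra_simps exp_minus_inverse)
  also have "\<dots> \<le> exp ?x * ?x"
    using exp_ge_add_one_self[of "- ?x"] by (intro mult_left_mono) auto
  finally have "?a * (exp ?x - 1) \<le> ?a * (exp ?x * ?x)"
    using assms by (intro mult_left_mono) auto
  also have "\<dots> = ?t * exp ?x" using assms by simp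
  also have "\<dots> \<le> \<tau> * exp ?x" using assms by (intro mult_right_mono) auto
  finally have "(y f + 1 / ?k) * (?a * (exp ?x - 1)) \<le> (y f + 1 / ?k) * (\<tau> * exp ?x)"
    using assms by (intro mult_left_mono) auto
  then show ?thesis unfolding g by (simp add: algebra_simps)
qed

definition dual :: "('f \<rightharpoonup> real \<times> real) \<Rightarrow> ('f \<Rightarrow> real) \<Rightarrow> real" where
  "dual \<phi> y = (SOME \<tau>. is_dual \<phi> y \<tau>)"

definition fractional :: "('f \<rightharpoonup> real \<times> real) list \<Rightarrow> ('f \<Rightarrow> real) \<times> real" where
  "fractional = foldl (\<lambda>(y, V) \<phi>. (grow \<phi> y (dual \<phi> y), V + dual \<phi> y)) (\<lambda>_. 0, 0)"

lemma ln_affine_mono: "0 \<le> u \<Longrightarrow> u \<le> v \<Longrightarrow> ln (real m * u + 1) \<le> ln (real m * v + 1)"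
  by (intro ln_mono add_right_mono mult_left_mono add_nonneg_pos) auto

section \<open>Dual variables and fractional openings of a fixed super-instance\<close>

locale facility_location =
  fixes I :: "('c, 'f) instance_data"
  assumes super: "super_instance I"
begin

abbreviation F :: "'f set" where "F \<equiv> facilities I"
abbreviation a :: "'f \<Rightarrow> real" where "a \<equiv> fac_cost I"
abbreviation offer :: "'c \<Rightarrow> 'f \<rightharpoonup> real \<times> real" where "offer c \<equiv> snd (request I c)"
abbreviation dist :: "'c \<Rightarrow> 'f \<Rightarrow> real" where "dist c f \<equiv> enn2real (conn_cost I c f)"
abbreviation reachable :: "'c \<Rightarrow> 'f set" where "reachable c \<equiv> dom (offer c)"
definition y :: "'c list \<Rightarrow> 'f \<Rightarrow> real" where "y cs = fst (fractional (map offer cs))"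
definition V :: "'c list \<Rightarrow> real" where "V cs = snd (fractional (map offer cs))"
definition \<tau> :: "'c list \<Rightarrow> 'c \<Rightarrow> real" where "\<tau> cs c = dual (offer c) (y cs)"

text \<open>If a client reaches no facility, no value satisfies \<open>is_dual\<close> and
  \<open>OPT\<close> is infinite, so the cost bounds are trivial there and are proved on served
  sequences.\<close>

definition served :: "'c list \<Rightarrow> bool" where
  "served cs \<longleftrightarrow> (\<forall>c\<in>set cs. reachable c \<noteq> {})"

lemma finF: "finite F" and finC: "finite (clients I)" and a_nonneg: "f \<in> F \<Longrightarrow> 0 \<le> a f"
  using super by (auto simp: super_instance_def)

lemma reachable: "reachable c = {f \<in> F. conn_cost I c f < \<infinity>}"
  by (auto simp: request_def split: if_splits)

lemma finite_reachable: "finite (reachable c)"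
  using finF by (simp add: reachable)

lemma open_cost: "f \<in> reachable c \<Longrightarrow> open_cost (offer c) f = a f"
  and dist_to: "f \<in> reachable c \<Longrightarrow> dist_to (offer c) f = dist c f"
  by (auto simp: open_cost_def dist_to_def request_def split: if_splits)

lemma fractional_Nil: "y [] f = 0" "V [] = 0"
  by (simp_all add: y_def V_def fractional_def)

lemma fractional_snoc:
  "y (cs @ [c]) = grow (offer c) (y cs) (\<tau> cs c)" "V (cs @ [c]) = V cs + \<tau> cs c"
  by (simp_all add: y_def V_def \<tau>_def fractional_def split: prod.split)

lemma y_nonneg: "0 \<le> y cs f"
proof (induction cs arbitrary: f rule: rev_induct)
  case (snoc c cs)
  then show ?case
    unfolding fractional_snoc by (intro grow_nonneg finite_reachable) (auto simp: open_cost reachable a_nonneg)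
qed (simp add: fractional_Nil)

lemma is_dual_\<tau>: "reachable c \<noteq> {} \<Longrightarrow> is_dual (offer c) (y cs) (\<tau> cs c)"
  unfolding \<tau>_def dual_def
  by (rule someI_ex, intro ex_is_dual finite_reachable y_nonneg)
    (auto simp: open_cost dist_to reachable a_nonneg)

lemma \<tau>_nonneg: "reachable c \<noteq> {} \<Longrightarrow> 0 \<le> \<tau> cs c"
  using is_dual_\<tau> by (simp add: is_dual_def)

lemma mass_near_le:
  "reachable c \<noteq> {} \<Longrightarrow>
   (\<Sum>f | f \<in> reachable c \<and> dist c f < \<tau> cs c. y (cs @ [c]) f) \<le> 1 / 2"
  using is_dual_\<tau>[of c cs] unfolding is_dual_def fractional_snoc
  by (auto cong: conj_cong simp: dist_to)

lemma mass_ball_ge: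
  "reachable c \<noteq> {} \<Longrightarrow>
   1 / 2 \<le> (\<Sum>f | f \<in> reachable c \<and> dist c f \<le> \<tau> cs c. y (cs @ [c]) f)"
  using is_dual_\<tau>[of c cs] unfolding is_dual_def fractional_snoc
  by (auto cong: conj_cong simp: dist_to)

lemma served_snoc: "served (cs @ [c]) \<longleftrightarrow> served cs \<and> reachable c \<noteq> {}"
  by (auto simp: served_def)

lemma V_mono: "reachable c \<noteq> {} \<Longrightarrow> V cs \<le> V (cs @ [c])"
  by (simp only: fractional_snoc) (simp add: \<tau>_nonneg)

lemma V_nonneg: "served cs \<Longrightarrow> 0 \<le> V cs"
proof (induction cs rule: rev_induct)
  case (snoc c cs)
  then show ?case using V_mono[of c cs] by (simp add: served_snoc)
qed (simp add: fractional_Nil)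

lemma y_far:
  assumes "f \<notin> reachable c \<or> \<tau> cs c \<le> dist c f \<and> a f \<noteq> 0"
  shows "y (cs @ [c]) f = y cs f"
  using assms unfolding fractional_snoc by (auto simp: grow_def dist_to open_cost)

lemma y_le_half_near:
  assumes "f \<in> reachable c" "dist c f < \<tau> cs c"
  shows "y (cs @ [c]) f \<le> 1 / 2"
proof -
  have "y (cs @ [c]) f \<le> (\<Sum>f | f \<in> reachable c \<and> dist c f < \<tau> cs c. y (cs @ [c]) f)"
    using assms finite_reachable y_nonneg by (intro member_le_sum) auto
  also have "\<dots> \<le> 1 / 2" using assms by (intro mass_near_le) auto
  finally show ?thesis .
qed

lemma y_zero_cost: "f \<in> reachable c \<Longrightarrow> a f = 0 \<Longrightarrow> y (cs @ [c]) f = 1"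
  unfolding fractional_snoc by (simp add: grow_def open_cost)

lemma y_le_1: "y cs f \<le> 1"
proof (induction cs rule: rev_induct)
  case (snoc c cs)
  show ?case
  proof (cases "f \<in> reachable c")
    case True
    consider "a f = 0" | "a f \<noteq> 0" "\<tau> cs c \<le> dist c f" | "dist c f < \<tau> cs c" by linarith
    then show ?thesis
    proof cases
      case 1 then show ?thesis using y_zero_cost[OF True, of cs] by simp
    next
      case 2 then show ?thesis using y_far[of f c cs] snoc by simp
    next
      case 3 then show ?thesis using y_le_half_near[OF True, of cs] by simp
    qed
  next
    case False then show ?thesis using y_far[of f c cs] snoc by simp
  qed
qed (simp add: fractional_Nil)

lemma y_mono: "y cs f \<le> y (cs @ [c]) f"
  unfolding fractional_snoc
  by (intro grow_mono finite_reachable y_nonneg y_le_1) (auto simp: open_cost reachable a_nonneg)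

text \<open>A unit of \<open>\<tau>\<close> pays at most y + 1/k for each facility strictly inside
  the ball: a mass of at most 1/2, plus 1/k for each of at most k facilities. Facilities of zero
  cost may jump to 1 for free.\<close>

lemma fractional_opening_cost:
  assumes "served cs"
  shows "(\<Sum>f\<in>F. a f * y cs f) \<le> 3 / 2 * V cs"
  using assms
proof (induction cs rule: rev_induct)
  case (snoc c cs)
  let ?N = "{f. f \<in> reachable c \<and> dist c f < \<tau> cs c}" and ?k = "real (card (reachable c))"
  let ?t = "\<tau> cs c"
  have c: "reachable c \<noteq> {}" and cs: "served cs" using snoc.prems by (simp_all add: served_snoc)
  have N: "?N \<subseteq> reachable c" "?N \<subseteq> F" by (auto simp: reachable)
  have t: "0 \<le> ?t" by (rule \<tau>_nonneg[OF c])
  have k: "card ?N / ?k \<le> 1"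
    using card_mono[OF finite_reachable N(1)] by (intro divide_le_eq_1[THEN iffD2]) auto
  have "(\<Sum>f\<in>F. a f * (y (cs @ [c]) f - y cs f)) \<le>
      (\<Sum>f\<in>F. if f \<in> ?N then ?t * (y (cs @ [c]) f + 1 / ?k) else 0)"
  proof (rule sum_mono)
    fix f assume f: "f \<in> F"
    show "a f * (y (cs @ [c]) f - y cs f) \<le> (if f \<in> ?N then ?t * (y (cs @ [c]) f + 1 / ?k) else 0)"
    proof (cases "f \<in> ?N \<and> a f > 0")
      case True
      then show ?thesis
        using grow_cost_le[of f "offer c" ?t "y cs"] y_nonneg[of cs f]
        unfolding fractional_snoc by (simp add: open_cost dist_to)
    next
      case False
      have pos: "0 \<le> ?t * (y (cs @ [c]) f + 1 / ?k)"
        using t y_nonneg[of "cs @ [c]" f] by (intro mult_nonneg_nonneg add_nonneg_nonneg) auto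
      show ?thesis
      proof (cases "a f = 0")
        case True then show ?thesis using pos by simp
      next
        case az: False
        then have "f \<notin> ?N" using False a_nonneg[OF f] by auto
        then have "y (cs @ [c]) f = y cs f" using az by (intro y_far) auto
        then show ?thesis using pos by simp
      qed
    qed
  qed
  also have "\<dots> = (\<Sum>f\<in>?N. ?t * (y (cs @ [c]) f + 1 / ?k))"
    using finF N(2) by (subst sum.inter_restrict[symmetric]) (auto intro!: sum.cong)
  also have "\<dots> = ?t * ((\<Sum>f\<in>?N. y (cs @ [c]) f) + card ?N / ?k)"
    by (simp add: sum_distrib_left sum.distrib algebra_simps)
  also have "\<dots> \<le> ?t * (1 / 2 + 1)"
    using mass_near_le[OF c, of cs] k t by (intro mult_left_mono add_mono) auto
  finally have "(\<Sum>f\<in>F. a f * y (cs @ [c]) f) \<le> (\<Sum>f\<in>F. a f * y cs f) + 3 / 2 * ?t"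
    by (simp add: algebra_simps sum_subtractf)
  then show ?case using snoc.IH[OF cs] fractional_snoc(2)[of cs c] by (simp add: algebra_simps)
qed (simp add: fractional_Nil)

text \<open>
  The growth of the potential \<open>a f * ln (m * y f + 1)\<close> pays for the part of the dual variable
  exceeding the distance to \<open>f\<close>, whichever offered facility \<open>f\<close> is used by the offline solution.
\<close>

lemma dual_step:
  assumes f: "f \<in> reachable c"
  shows "\<tau> cs c \<le> dist c f + (a f * ln (card F * y (cs @ [c]) f + 1) - a f * ln (card F * y cs f + 1))"
proof (cases "\<tau> cs c \<le> dist c f")
  case True
  have "a f * ln (card F * y cs f + 1) \<le> a f * ln (card F * y (cs @ [c]) f + 1)"
    using a_nonneg f y_nonneg[of cs f] y_mono[of cs f c]
    by (intro mult_left_mono ln_affine_mono) (auto simp: reachable)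
  with True show ?thesis by simp
next
  case False
  \<comment> \<open>A facility of zero cost has weight 1 once offered, too much for an open ball of
    mass at most one half.\<close>
  have az: "a f \<noteq> 0"
  proof
    assume "a f = 0"
    then show False using y_zero_cost[OF f, of cs] y_le_half_near[OF f, of cs] False by simp
  qed
  then have a0: "0 < a f" using a_nonneg[of f] f by (simp add: reachable)
  let ?k = "real (card (reachable c))" and ?m = "real (card F)" and ?x = "(\<tau> cs c - dist c f) / a f"
  have k: "0 < ?k" using f finite_reachable card_gt_0_iff by auto
  have km: "?k \<le> ?m" using finF by (auto simp: reachable intro!: card_mono)
  have y': "y (cs @ [c]) f = (y cs f + 1 / ?k) * exp ?x - 1 / ?k"
    unfolding fractional_snoc using f az False by (simp add: grow_def open_cost dist_to)
  have x: "0 \<le> ?x" using a0 False by simp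
  \<comment> \<open>The algorithm knows only the number \<open>?k\<close> of offered facilities,
    while the potential uses \<open>?m\<close>. As \<open>?k \<le> ?m\<close>, the larger offset
    \<open>1 / ?k\<close> makes \<open>?m * y + 1\<close> grow at least by the factor
    \<open>exp ?x\<close>.\<close>
  have "0 \<le> (?m / ?k - 1) * (exp ?x - 1)"
    using k km x by (intro mult_nonneg_nonneg) auto
  then have "(?m * y cs f + 1) * exp ?x \<le> ?m * y (cs @ [c]) f + 1"
    unfolding y' by (simp add: algebra_simps)
  moreover have pos: "0 < ?m * y cs f + 1"
    using y_nonneg[of cs f] by (intro add_nonneg_pos) auto
  ultimately have "ln ((?m * y cs f + 1) * exp ?x) \<le> ln (?m * y (cs @ [c]) f + 1)"
    by (intro ln_mono) auto
  then have "ln (?m * y cs f + 1) + ?x \<le> ln (?m * y (cs @ [c]) f + 1)"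
    using pos by (simp add: ln_mult)
  then have "a f * (ln (?m * y cs f + 1) + ?x) \<le> a f * ln (?m * y (cs @ [c]) f + 1)"
    using a0 by (intro mult_left_mono) auto
  then show ?thesis using a0 by (simp add: distrib_left)
qed

text \<open>Summing \<open>dual_step\<close> over the clients, the logarithmic terms telescope for
  each facility and start at ln 1 = 0.\<close>

lemma V_le_assignment:
  assumes "\<And>c. c \<in> set cs \<Longrightarrow> g c \<in> reachable c"
  shows "V cs \<le> (\<Sum>c\<leftarrow>cs. dist c (g c)) + (\<Sum>f\<in>g ` set cs. a f * ln (card F * y cs f + 1))"
  using assms
proof (induction cs rule: rev_induct)
  case (snoc c cs)
  let ?\<Phi> = "\<lambda>cs f. a f * ln (card F * y cs f + 1)"
  have gc: "g c \<in> reachable c" using snoc.prems by simp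
  have aF: "0 \<le> a f" if "f \<in> g ` set (cs @ [c])" for f
    using that snoc.prems a_nonneg by (auto simp: reachable)
  have \<Phi>0: "0 \<le> ?\<Phi> cs' f" if "f \<in> g ` set (cs @ [c])" for f cs'
    using aF[OF that] y_nonneg[of cs' f] by (intro mult_nonneg_nonneg ln_ge_zero) auto
  have mono: "?\<Phi> cs f \<le> ?\<Phi> (cs @ [c]) f" if "f \<in> g ` set (cs @ [c])" for f
    using aF[OF that] y_nonneg[of cs f] y_mono[of cs f c]
    by (intro mult_left_mono ln_affine_mono) auto
  let ?G = "g ` set (cs @ [c])"
  have "V (cs @ [c]) = V cs + \<tau> cs c" by (rule fractional_snoc)
  also have "V cs \<le> (\<Sum>c\<leftarrow>cs. dist c (g c)) + (\<Sum>f\<in>g ` set cs. ?\<Phi> cs f)"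
    using snoc by auto
  \<comment> \<open>The index set is enlarged while the old potentials still apply. Then
    \<open>g c\<close> is split off to pay for the new client, and the other terms only
    grow.\<close>
  also have "(\<Sum>f\<in>g ` set cs. ?\<Phi> cs f) \<le> (\<Sum>f\<in>?G. ?\<Phi> cs f)"
    using \<Phi>0 by (intro sum_mono2) auto
  also have "(\<Sum>f\<in>?G. ?\<Phi> cs f) = ?\<Phi> cs (g c) + (\<Sum>f\<in>?G - {g c}. ?\<Phi> cs f)"
    by (rule sum.remove) auto
  also have "(\<Sum>f\<in>?G - {g c}. ?\<Phi> cs f) \<le> (\<Sum>f\<in>?G - {g c}. ?\<Phi> (cs @ [c]) f)"
    using mono by (intro sum_mono) auto
  also note dual_step[OF gc, of cs]
  finally have "V (cs @ [c]) \<le> (\<Sum>c\<leftarrow>cs. dist c (g c)) + dist c (g c) +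
      (?\<Phi> (cs @ [c]) (g c) + (\<Sum>f\<in>?G - {g c}. ?\<Phi> (cs @ [c]) f))"
    by simp
  also have "?\<Phi> (cs @ [c]) (g c) + (\<Sum>f\<in>?G - {g c}. ?\<Phi> (cs @ [c]) f) = (\<Sum>f\<in>?G. ?\<Phi> (cs @ [c]) f)"
    by (rule sum.remove[symmetric]) auto
  finally show ?case by simp
qed (simp add: fractional_Nil)

text \<open>As \<open>y\<close> is at most 1, every logarithm is at most ln (|F| + 1). Dividing by
  the factor first gives a lower bound common to all assignments, which passes to the
  infimum.\<close>

lemma V_le_OPT:
  assumes "served cs"
  shows "ennreal (V cs) \<le> ennreal (1 + ln (real (card F) + 1)) * OPT I cs"
proof -
  define L where "L = 1 + ln (real (card F) + 1)"
  have L: "1 \<le> L" by (simp add: L_def)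
  then have Lpos: "0 < L" by linarith
  have "ennreal (V cs) / ennreal L \<le> OPT I cs"
    unfolding OPT_def
  proof (rule INF_greatest)
    fix g assume "g \<in> {g. g ` set cs \<subseteq> F}"
    then have g: "g ` set cs \<subseteq> F" by simp
    let ?t = "total_cost I (map (\<lambda>c. (c, g c)) cs)"
    have conn: "connection_cost I (map (\<lambda>c. (c, g c)) cs) = (\<Sum>c\<leftarrow>cs. conn_cost I c (g c))"
      by (simp add: connection_cost_def comp_def)
    show "ennreal (V cs) / ennreal L \<le> ?t"
    proof (cases "\<forall>c\<in>set cs. conn_cost I c (g c) < \<infinity>")
      case True
      let ?D = "\<Sum>c\<leftarrow>cs. dist c (g c)" and ?A = "\<Sum>f\<in>g ` set cs. a f"
      have D: "(\<Sum>c\<leftarrow>cs. conn_cost I c (g c)) = ennreal ?D" and D0: "0 \<le> ?D"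
        using True by (induction cs) (auto simp: less_top)
      have A0: "0 \<le> ?A" using g a_nonneg by (intro sum_nonneg) auto
      have "(\<Sum>f\<in>snd ` set (map (\<lambda>c. (c, g c)) cs). ennreal (a f)) = ennreal ?A"
        using g a_nonneg by (subst sum_ennreal[symmetric]) (auto simp: image_image)
      then have t: "?t = ennreal (?D + ?A)"
        using conn D D0 A0 by (simp add: total_cost_def opening_cost_def)
      have "V cs \<le> ?D + (\<Sum>f\<in>g ` set cs. a f * ln (card F * y cs f + 1))"
        using g True by (intro V_le_assignment) (auto simp: reachable)
      also have "\<dots> \<le> ?D + (\<Sum>f\<in>g ` set cs. a f * L)"
      proof (intro add_left_mono sum_mono mult_left_mono)
        fix f
        have "ln (card F * y cs f + 1) \<le> ln (real (card F) * 1 + 1)"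
          using y_nonneg[of cs f] y_le_1[of cs f]
          by (intro ln_affine_mono) auto
        then show "ln (card F * y cs f + 1) \<le> L" by (simp add: L_def)
      qed (use g a_nonneg in auto)
      also have "\<dots> \<le> (?D + ?A) * L"
        using L D0 mult_left_mono[OF L D0] by (simp only: sum_distrib_right[symmetric] distrib_right)
      finally have "V cs / L \<le> ?D + ?A" using Lpos by (simp only: pos_divide_le_eq)
      then show ?thesis
        using L V_nonneg[OF assms] unfolding t by (subst divide_ennreal) (auto intro: ennreal_leI)
    next
      case False
      then obtain c where c: "c \<in> set cs" "conn_cost I c (g c) = \<infinity>"
        by (auto simp: less_top[symmetric])
      then have "\<infinity> \<le> (\<Sum>c\<leftarrow>cs. conn_cost I c (g c))"
        using member_le_sum_list[of "conn_cost I c (g c)" "map (\<lambda>c. conn_cost I c (g c)) cs"] by force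
      then have "?t = \<infinity>" by (simp add: total_cost_def conn top_unique)
      then show ?thesis by simp
    qed
  qed
  then have "ennreal L * (ennreal (V cs) / ennreal L) \<le> ennreal L * OPT I cs"
    by (intro mult_left_mono) auto
  moreover have "ennreal L * (ennreal (V cs) / ennreal L) = ennreal (V cs)"
    using L V_nonneg[OF assms] by (subst divide_ennreal) (auto simp: ennreal_mult[symmetric])
  ultimately show ?thesis by (simp add: L_def)
qed

lemma OPT_not_served:
  assumes "\<not> served cs"
  shows "OPT I cs = \<infinity>"
proof -
  obtain c where c: "c \<in> set cs" "reachable c = {}" using assms by (auto simp: served_def)
  have "\<infinity> \<le> OPT I cs"
    unfolding OPT_def
  proof (rule INF_greatest)
    fix g assume "g \<in> {g. g ` set cs \<subseteq> F}"
    then have "g c \<in> F" "g c \<notin> reachable c" using c by auto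
    then have "conn_cost I c (g c) = \<infinity>" unfolding reachable by (simp add: less_top[symmetric])
    then have "\<infinity> \<le> (\<Sum>c\<leftarrow>cs. conn_cost I c (g c))"
      using c(1) member_le_sum_list[of "conn_cost I c (g c)" "map (\<lambda>c. conn_cost I c (g c)) cs"]
      by force
    then show "\<infinity> \<le> total_cost I (map (\<lambda>c. (c, g c)) cs)"
      by (simp add: total_cost_def connection_cost_def comp_def top_unique)
  qed
  then show ?thesis by (simp add: top_unique)
qed

end

section \<open>Randomized rounding\<close>

definition indep_subset :: "'f set \<Rightarrow> ('f \<Rightarrow> real) \<Rightarrow> 'f set pmf" where
  "indep_subset S p = map_pmf (\<lambda>\<omega>. {f \<in> S. \<omega> f}) (Pi_pmf S False (\<lambda>f. bernoulli_pmf (p f)))"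

lemma set_indep_subset: "set_pmf (indep_subset S p) \<subseteq> Pow S"
  by (auto simp: indep_subset_def)

lemma prob_indep_subset_disjoint:
  assumes "finite S" "A \<subseteq> S" "\<And>f. f \<in> S \<Longrightarrow> 0 \<le> p f \<and> p f \<le> 1"
  shows "measure_pmf.prob (indep_subset S p) {X. X \<inter> A = {}} = (\<Prod>f\<in>A. 1 - p f)"
proof -
  let ?M = "Pi_pmf S False (\<lambda>f. bernoulli_pmf (p f))"
  let ?B = "\<lambda>f. if f \<in> A then {False} else UNIV"
  have "measure_pmf.prob (indep_subset S p) {X. X \<inter> A = {}} = measure_pmf.prob ?M (Pi S ?B)"
    unfolding indep_subset_def using assms(2)
    by (auto intro!: arg_cong[where f = "measure_pmf.prob ?M"] simp: Pi_def split: if_splits)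
  also have "\<dots> = (\<Prod>f\<in>S. measure_pmf.prob (bernoulli_pmf (p f)) (?B f))"
    by (rule measure_Pi_pmf_Pi[OF assms(1)])
  also have "\<dots> = (\<Prod>f\<in>S. if f \<in> A then 1 - p f else 1)"
    using assms(3) by (intro prod.cong) (auto simp: measure_pmf_single)
  also have "\<dots> = (\<Prod>f\<in>A. 1 - p f)"
    using assms(1,2) by (simp add: prod.If_cases Int_absorb1)
  finally show ?thesis .
qed

lemma expectation_sum_indep_subset:
  fixes a :: "'f \<Rightarrow> real"
  assumes "finite S" "\<And>f. f \<in> S \<Longrightarrow> 0 \<le> p f \<and> p f \<le> 1"
  shows "measure_pmf.expectation (indep_subset S p) (\<lambda>X. \<Sum>f\<in>X. a f) = (\<Sum>f\<in>S. a f * p f)"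
proof -
  let ?P = "indep_subset S p"
  have fin: "finite (set_pmf ?P)"
    using set_indep_subset[of S p] assms(1) by (meson finite_Pow_iff finite_subset)
  have int: "integrable (measure_pmf ?P) (f :: 'f set \<Rightarrow> real)" for f
    using fin by (rule integrable_measure_pmf_finite)
  have pr: "measure_pmf.prob ?P {X. f \<in> X} = p f" if "f \<in> S" for f
  proof -
    have "measure_pmf.prob ?P {X. X \<inter> {f} = {}} = 1 - p f"
      using prob_indep_subset_disjoint[of S "{f}" p] assms that by simp
    moreover have "measure_pmf.prob ?P {X. f \<in> X} = 1 - measure_pmf.prob ?P {X. X \<inter> {f} = {}}"
      by (subst measure_pmf.prob_compl[symmetric]) (auto intro!: arg_cong[where f = "measure_pmf.prob ?P"])
    ultimately show ?thesis by simp
  qed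
  have "measure_pmf.expectation ?P (\<lambda>X. \<Sum>f\<in>X. a f) =
      measure_pmf.expectation ?P (\<lambda>X. \<Sum>f\<in>S. a f * indicator {X. f \<in> X} X)"
  proof (intro integral_cong_AE)
    show "AE X in measure_pmf ?P. (\<Sum>f\<in>X. a f) = (\<Sum>f\<in>S. a f * indicator {X. f \<in> X} X)"
    proof (rule AE_pmfI)
      fix X assume "X \<in> set_pmf ?P"
      then have "X \<subseteq> S" using set_indep_subset by auto
      then show "(\<Sum>f\<in>X. a f) = (\<Sum>f\<in>S. a f * indicator {X. f \<in> X} X)"
        using assms(1) by (intro sum.mono_neutral_cong_left) (auto simp: indicator_def)
    qed
  qed auto
  also have "\<dots> = (\<Sum>f\<in>S. a f * measure_pmf.prob ?P {X. f \<in> X})"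
    by (subst Bochner_Integration.integral_sum) (auto intro: int)
  finally show ?thesis using pr by simp
qed

section \<open>Phase scales and rounded radii\<close>

definition scale :: "real \<Rightarrow> real" where
  "scale v = (if v \<le> 0 then 0 else 2 powr \<lfloor>log 2 v\<rfloor>)"

lemma scale_nonneg: "0 \<le> scale v"
  by (simp add: scale_def)

lemma scale_le: "0 \<le> v \<Longrightarrow> scale v \<le> v"
  by (auto simp: scale_def powr_le_iff)

lemma le_2_scale: "v \<le> 2 * scale v"
proof (cases "v \<le> 0")
  case False
  then have "v = 2 powr log 2 v" by simp
  also have "\<dots> \<le> 2 powr (1 + \<lfloor>log 2 v\<rfloor>)" by (intro powr_mono) linarith+
  also have "\<dots> = 2 * 2 powr \<lfloor>log 2 v\<rfloor>" by (simp add: powr_add)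
  finally show ?thesis using False by (simp add: scale_def)
qed (simp add: scale_def)

lemma scale_jump:
  assumes "v \<le> v'" "scale v \<noteq> scale v'"
  shows "2 * scale v \<le> scale v'"
proof (cases "v \<le> 0")
  case False
  then have "\<lfloor>log 2 v\<rfloor> \<le> \<lfloor>log 2 v'\<rfloor>" "\<lfloor>log 2 v\<rfloor> \<noteq> \<lfloor>log 2 v'\<rfloor>"
    using assms by (auto simp: scale_def intro!: floor_mono)
  then have "2 powr (1 + \<lfloor>log 2 v\<rfloor>) \<le> (2 :: real) powr \<lfloor>log 2 v'\<rfloor>"
    by (intro powr_mono) linarith+
  then have "2 * 2 powr \<lfloor>log 2 v\<rfloor> \<le> (2 :: real) powr \<lfloor>log 2 v'\<rfloor>"
    by (simp add: powr_add)
  then show ?thesis using False assms(1) by (simp add: scale_def)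
qed (simp add: scale_def)

text \<open>The greatest exponent yields the smallest admissible radius. Stopping at
  \<open>Suc i\<close> halvings keeps the number of balls per client bounded.\<close>

definition radius :: "real \<Rightarrow> nat \<Rightarrow> real \<Rightarrow> real" where
  "radius Z i t = 2 * Z / 2 ^ (GREATEST k. k \<le> Suc i \<and> t \<le> 2 * Z / 2 ^ k)"

text \<open>Either one more halving would fall below \<open>t\<close>, which loses a factor of two,
  or the halvings are exhausted, which loses at most \<open>Z / 2 ^ i\<close>. With \<open>i\<close>
  the number of earlier clients, these additive losses are summable.\<close>

lemma radius:
  assumes "0 \<le> t" "t \<le> 2 * Z"
  shows "\<exists>k\<le>Suc i. radius Z i t = 2 * Z / 2 ^ k" "t \<le> radius Z i t" "radius Z i t \<le> 2 * t + Z / 2 ^ i"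
proof -
  let ?P = "\<lambda>k. k \<le> Suc i \<and> t \<le> 2 * Z / 2 ^ k"
  define k where "k = (GREATEST k. ?P k)"
  have "?P 0" using assms by simp
  then have k: "?P k" unfolding k_def by (rule GreatestI_nat[where b = "Suc i"]) simp
  have r: "radius Z i t = 2 * Z / 2 ^ k" by (simp add: radius_def k_def)
  show "\<exists>k\<le>Suc i. radius Z i t = 2 * Z / 2 ^ k" "t \<le> radius Z i t" using k r by auto
  have Z: "0 \<le> Z" using assms by simp
  show "radius Z i t \<le> 2 * t + Z / 2 ^ i"
  proof (cases "k = Suc i")
    case True then show ?thesis using assms by (simp add: r)
  next
    case False
    have "\<not> ?P (Suc k)"
      using Greatest_le_nat[of ?P "Suc k" "Suc i"] unfolding k_def[symmetric] by auto
    then have "2 * Z / 2 ^ Suc k < t" using k False by simp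
    then have "radius Z i t \<le> 2 * t" by (simp add: r field_simps)
    moreover have "0 \<le> Z / 2 ^ i" using Z by simp
    ultimately show ?thesis by linarith
  qed
qed

text \<open>
  The opened facilities of the current phase, the hazard already applied to each facility, and the
  hazard rate per unit of fractional opening.
\<close>

type_synonym 'f state = "'f set \<times> ('f \<Rightarrow> real) \<times> nat"

text \<open>A facility stays closed with probability exp of minus its hazard increment, so by
  independence a set stays closed with probability exp of minus its total increment. Facilities of
  zero cost count as open.\<close>

definition serve ::
    "'f set \<Rightarrow> ('f \<Rightarrow> real) \<Rightarrow> ('f \<Rightarrow> real) \<Rightarrow> 'f state \<Rightarrow> ('f \<times> 'f state) pmf" where
  "serve S a y = (\<lambda>(Q, H, l).
     if \<exists>f\<in>S. f \<in> Q \<or> a f = 0 then return_pmf (SOME f. f \<in> S \<and> (f \<in> Q \<or> a f = 0), Q, H, l)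
     else
       let H' = (\<lambda>f. if f \<in> S then real l * y f else H f)
       in map_pmf
            (\<lambda>X. if X \<noteq> {} then (SOME f. f \<in> X, Q \<union> X, H', l)
                 else (arg_min_on a S, insert (arg_min_on a S) Q, H', Suc l))
            (indep_subset S (\<lambda>f. 1 - exp (H f - real l * y f))))"

text \<open>The algorithm reads costs from the current offer, the analysis from the super-instance;
  they agree on the ball.\<close>

lemma serve_cong:
  assumes "\<And>f. f \<in> S \<Longrightarrow> a f = a' f"
  shows "serve S a y = serve S a' y"
proof -
  have "arg_min_on a S = arg_min_on a' S"
    unfolding arg_min_on_def arg_min_def is_arg_min_def
    by (rule arg_cong[where f = Eps]) (auto simp: fun_eq_iff assms)
  moreover have "(f \<in> S \<and> (f \<in> Q \<or> a f = 0)) = (f \<in> S \<and> (f \<in> Q \<or> a' f = 0))" for f Q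
    using assms by auto
  ultimately show ?thesis by (simp only: serve_def Bex_def)
qed

lemma set_pmf_serve:
  assumes "finite S" "S \<noteq> {}" "(f, Q', H', l') \<in> set_pmf (serve S a y (Q, H, l))"
  shows "f \<in> S \<and> Q' \<subseteq> Q \<union> S \<and> l \<le> l' \<and> (\<forall>f. H' f = H f \<or> f \<in> S \<and> H' f = real l * y f)"
proof (cases "\<exists>f\<in>S. f \<in> Q \<or> a f = 0")
  case True
  then have "(SOME f. f \<in> S \<and> (f \<in> Q \<or> a f = 0)) \<in> S"
    by (metis (mono_tags, lifting) someI_ex)
  then show ?thesis using assms True by (auto simp: serve_def)
next
  case False
  have "arg_min_on a S \<in> S" using assms by (intro arg_min_if_finite)
  moreover obtain X where "X \<in> set_pmf (indep_subset S (\<lambda>f. 1 - exp (H f - real l * y f)))"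
    and out: "(f, Q', H', l') =
      (if X \<noteq> {} then (SOME f. f \<in> X, Q \<union> X, \<lambda>f. if f \<in> S then real l * y f else H f, l)
       else (arg_min_on a S, insert (arg_min_on a S) Q, \<lambda>f. if f \<in> S then real l * y f else H f, Suc l))"
    using assms(3) unfolding serve_def prod.case if_not_P[OF False] Let_def by (simp only: set_map_pmf) blast
  then have "X \<subseteq> S" using set_indep_subset by blast
  moreover have "(SOME f. f \<in> X) \<in> X" if "X \<noteq> {}" using that by (simp add: some_in_eq)
  ultimately show ?thesis using out by (cases "X = {}") auto
qed

lemma finite_set_pmf_serve: "finite S \<Longrightarrow> finite (set_pmf (serve S a y s))"
  using finite_subset[OF set_indep_subset] by (auto simp: serve_def Let_def split: prod.split)

section \<open>Load of the closed balls and the rounding potential\<close>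

definition free :: "('f \<Rightarrow> real) \<Rightarrow> 'f set \<Rightarrow> 'f set \<Rightarrow> bool" where
  "free a Q A \<longleftrightarrow> A \<inter> Q = {} \<and> (\<forall>f\<in>A. a f \<noteq> 0)"

text \<open>A hazard increment h multiplies the term of a ball by exp h, while the ball stays closed
  with probability at most exp (-h). So each term is a supermartingale.\<close>

definition load ::
    "('f \<Rightarrow> real) \<Rightarrow> ('j \<Rightarrow> 'f set) \<Rightarrow> 'j set \<Rightarrow> 'f set \<Rightarrow> ('f \<Rightarrow> real) \<Rightarrow> real" where
  "load a T J Q H = (\<Sum>j\<in>J. if free a Q (T j) then exp (\<Sum>f\<in>T j. H f) else 0)"

text \<open>
  The factor of \<open>3 * R\<close> is an upper bound for the expected number of further rate increases: below the
  threshold \<open>L\<close> they are paid by the maximum, and above it by the term of the ball of the arriving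
  client, which is at least one by then. The last two terms prepay openings caused by hazard, as
  \<open>R\<close> bounds the fractional opening cost of the phase.
\<close>

definition potential ::
    "'f set \<Rightarrow> ('f \<Rightarrow> real) \<Rightarrow> ('j \<Rightarrow> 'f set) \<Rightarrow> real \<Rightarrow> real \<Rightarrow> real \<Rightarrow> 'j set \<Rightarrow> 'f set \<Rightarrow>
     'f state \<Rightarrow> real" where
  "potential F a T R w L J B = (\<lambda>(Q, H, l).
     (\<Sum>f\<in>B \<union> Q. a f) + 3 * R * (max 0 (L - l) + w * load a T J Q H) + l * R - (\<Sum>f\<in>F. a f * H f))"

lemma load_nonneg: "0 \<le> load a T J Q H"
  unfolding load_def by (intro sum_nonneg) auto

lemma load_subset:
  assumes "finite J" "J' \<subseteq> J" shows "load a T J' Q H \<le> load a T J Q H"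
  unfolding load_def using assms by (intro sum_mono2) auto

lemma potential_ge:
  assumes "0 \<le> R" "0 \<le> w" "(\<Sum>f\<in>F. a f * H f) \<le> l * R"
    and "finite F" "B \<subseteq> F" "Q \<subseteq> F" "\<And>f. f \<in> F \<Longrightarrow> 0 \<le> a f"
  shows "(\<Sum>f\<in>B. a f) \<le> potential F a T R w L J B (Q, H, l)"
proof -
  have "(\<Sum>f\<in>B. a f) \<le> (\<Sum>f\<in>B \<union> Q. a f)"
    using assms by (intro sum_mono2) (auto intro: finite_subset)
  moreover have "0 \<le> 3 * R * (max 0 (L - l) + w * load a T J Q H)"
    using assms load_nonneg[of a T J Q H] by (intro mult_nonneg_nonneg add_nonneg_nonneg) auto
  ultimately show ?thesis using assms(3) by (simp add: potential_def)
qed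

text \<open>\<open>j0\<close> indexes the ball of the arriving client. If this ball has an open
  facility or one of zero cost, nothing new is paid. Otherwise the accumulated hazard pays for the
  random openings, and a failure costs at most \<open>3 * R\<close>: \<open>2 * R\<close> for the
  cheapest facility and \<open>R\<close> for the growth of \<open>l * R\<close>. Below the threshold
  the maximum pays this; above it, the load released by dropping \<open>j0\<close> does.\<close>

lemma expectation_serve_potential:
  fixes F :: "'f set" and T :: "'j \<Rightarrow> 'f set"
  assumes F: "finite F" "B \<subseteq> F" "Q \<subseteq> F" "\<And>f. f \<in> F \<Longrightarrow> 0 \<le> a f"
    and S: "S \<subseteq> F" "1 / 2 \<le> (\<Sum>f\<in>S. y f)"
    and H: "\<And>f. f \<in> F \<Longrightarrow> H f \<le> l * y f"
    and y: "\<And>f. f \<in> F \<Longrightarrow> 0 \<le> y f" "(\<Sum>f\<in>F. a f * y f) \<le> R"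
    and J: "finite J" "j0 \<in> J" "J' \<subseteq> J - {j0}" "T j0 = S" "\<And>j. j \<in> J \<Longrightarrow> T j \<subseteq> F"
    and w: "0 \<le> w" "1 \<le> w * exp ((L - 1) / 2)"
  shows "measure_pmf.expectation (serve S a y (Q, H, l))
           (\<lambda>(f, s). potential F a T R w L J' (insert f B) s) \<le> potential F a T R w L J B (Q, H, l)"
proof -
  have R: "0 \<le> R" using y F by (intro order_trans[OF sum_nonneg y(2)]) auto
  have finS: "finite S" and finBQ: "finite (B \<union> Q)" using F S by (auto intro: finite_subset)
  have Sne: "S \<noteq> {}" using S(2) by auto
  have J'J: "J' \<subseteq> J" using J by auto
  show ?thesis
  proof (cases "\<exists>f\<in>S. f \<in> Q \<or> a f = 0")
    case True
    define f where "f = (SOME f. f \<in> S \<and> (f \<in> Q \<or> a f = 0))"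
    have f: "f \<in> S \<and> (f \<in> Q \<or> a f = 0)"
      unfolding f_def using True by (metis (mono_tags, lifting) someI_ex)
    have "(\<Sum>f\<in>insert f B \<union> Q. a f) = (\<Sum>f\<in>B \<union> Q. a f)"
      using f finBQ by (auto simp: sum.insert_if insert_absorb)
    moreover have "3 * R * (max 0 (L - l) + w * load a T J' Q H) \<le> 3 * R * (max 0 (L - l) + w * load a T J Q H)"
      using R w load_subset[OF J(1) J'J, of a T Q H] by (intro mult_left_mono add_left_mono) auto
    ultimately have "potential F a T R w L J' (insert f B) (Q, H, l) \<le> potential F a T R w L J B (Q, H, l)"
      by (simp add: potential_def)
    then show ?thesis using True by (simp add: serve_def f_def)
  next
    case False
    define H' where "H' = (\<lambda>f. if f \<in> S then real l * y f else H f)"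
    define \<Delta> where "\<Delta> f = l * y f - H f" for f
    define p where "p f = 1 - exp (H f - real l * y f)" for f
    define P where "P = indep_subset S p"
    define f0 where "f0 = arg_min_on a S"
    define out where "out X = (if X \<noteq> {} then (SOME f. f \<in> X, Q \<union> X, H', l) else (f0, insert f0 Q, H', Suc l))" for X
    have serve: "serve S a y (Q, H, l) = map_pmf out P"
      unfolding serve_def prod.case if_not_P[OF False] Let_def
      by (simp only: P_def p_def[abs_def] out_def[abs_def] H'_def f0_def)
    have finP: "finite (set_pmf P)"
      using set_indep_subset[of S p] finS unfolding P_def by (meson finite_Pow_iff finite_subset)
    have int: "integrable (measure_pmf P) (g :: 'f set \<Rightarrow> real)" for g
      using finP by (rule integrable_measure_pmf_finite)
    have \<Delta>: "0 \<le> \<Delta> f" if "f \<in> S" for f using H that S by (auto simp: \<Delta>_def)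
    have p: "0 \<le> p f \<and> p f \<le> 1 \<and> p f \<le> \<Delta> f \<and> 1 - p f = exp (- \<Delta> f)" if "f \<in> S" for f
    proof -
      have "p f \<le> \<Delta> f"
        unfolding p_def \<Delta>_def using exp_ge_add_one_self[of "H f - l * y f"] by linarith
      then show ?thesis using \<Delta>[OF that] by (auto simp: p_def \<Delta>_def)
    qed
    have prob: "measure_pmf.prob P {X. X \<inter> A = {}} = exp (- (\<Sum>f\<in>A. \<Delta> f))" if "A \<subseteq> S" for A
    proof -
      have "measure_pmf.prob P {X. X \<inter> A = {}} = (\<Prod>f\<in>A. 1 - p f)"
        unfolding P_def using finS that p by (intro prob_indep_subset_disjoint) auto
      also have "\<dots> = (\<Prod>f\<in>A. exp (- \<Delta> f))" using p that by (intro prod.cong) auto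
      also have "\<dots> = exp (- (\<Sum>f\<in>A. \<Delta> f))"
        using finS that by (simp add: exp_sum finite_subset sum_negf[symmetric])
      finally show ?thesis .
    qed
    have f0: "f0 \<in> S" "\<And>f. f \<in> S \<Longrightarrow> a f0 \<le> a f"
      unfolding f0_def using finS Sne by (auto intro: arg_min_if_finite arg_min_least)
    \<comment> \<open>\<open>S\<close> carries at least half a unit of weight, each unit costing no
      less than the cheapest facility.\<close>
    have af0: "a f0 \<le> 2 * R"
    proof -
      have "a f0 * (1 / 2) \<le> a f0 * (\<Sum>f\<in>S. y f)" using S F f0 by (intro mult_left_mono) auto
      also have "\<dots> \<le> (\<Sum>f\<in>S. a f * y f)"
        unfolding sum_distrib_left using S y f0 by (intro sum_mono mult_right_mono) auto
      also have "\<dots> \<le> (\<Sum>f\<in>F. a f * y f)" using S F y by (intro sum_mono2) auto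
      finally show ?thesis using y by simp
    qed
    define J1 where "J1 = {j \<in> J'. free a Q (T j)}"
    have J1: "finite J1" "J1 \<subseteq> J" using J J'J by (auto simp: J1_def intro: finite_subset)
    define M where "M j = exp (\<Sum>f\<in>T j. H' f)" for j
    \<comment> \<open>The failure cost not covered by the maximum: for \<open>l\<close> up to
      \<open>L - 1\<close> the maximum drops by a full unit and nothing remains.\<close>
    define e where "e = (if L - 1 < l then 3 * R else 0)"
    define base where "base = (\<Sum>f\<in>B \<union> Q. a f) + 3 * R * max 0 (L - l) + l * R - (\<Sum>f\<in>F. a f * H f) - (\<Sum>f\<in>S. a f * \<Delta> f)"
    \<comment> \<open>This bound on the new potential is linear in the opening costs and survival
      indicators, so its expectation can be computed termwise.\<close>
    define U where "U X = base + (\<Sum>f\<in>X. a f) + 3 * R * w * (\<Sum>j\<in>J1. M j * indicator {X. X \<inter> (T j \<inter> S) = {}} X)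
        + e * indicator {X. X \<inter> S = {}} X" for X
    have HH': "(\<Sum>f\<in>F. a f * H' f) = (\<Sum>f\<in>F. a f * H f) + (\<Sum>f\<in>S. a f * \<Delta> f)"
    proof -
      have "(\<Sum>f\<in>F. a f * H' f) = (\<Sum>f\<in>F. a f * H f + (if f \<in> S then a f * \<Delta> f else 0))"
        by (intro sum.cong) (auto simp: H'_def \<Delta>_def algebra_simps)
      then show ?thesis using F S by (simp add: sum.distrib sum.inter_restrict[symmetric] Int_absorb1)
    qed
    have loadU: "load a T J' Q1 H' \<le> (\<Sum>j\<in>J1. M j * indicator {X. X \<inter> (T j \<inter> S) = {}} X)"
      if "Q \<union> X \<subseteq> Q1" "X \<subseteq> S" for X Q1
    proof -
      have "load a T J' Q1 H' = (\<Sum>j\<in>J1. if free a Q1 (T j) then M j else 0)"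
        unfolding load_def M_def J1_def using that J J'J
        by (intro sum.mono_neutral_cong_right) (auto simp: free_def intro: finite_subset)
      also have "\<dots> \<le> (\<Sum>j\<in>J1. M j * indicator {X. X \<inter> (T j \<inter> S) = {}} X)"
        using that by (intro sum_mono) (auto simp: free_def indicator_def M_def)
      finally show ?thesis .
    qed
    have le_U: "(case out X of (f, s) \<Rightarrow> potential F a T R w L J' (insert f B) s) \<le> U X"
      if "X \<in> set_pmf P" for X
    proof -
      have X: "X \<subseteq> S" using that set_indep_subset unfolding P_def by blast
      have finX: "finite X" using X finS finite_subset by blast
      define l' where "l' = (if X = {} then Suc l else l)"
      define Q' where "Q' = (if X = {} then insert f0 Q else Q \<union> X)"
      define f where "f = (if X = {} then f0 else SOME f. f \<in> X)"
      have fQ': "f \<in> Q'" by (cases "X = {}") (auto simp: f_def Q'_def some_in_eq)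
      have out: "out X = (f, Q', H', l')" by (auto simp: out_def f_def Q'_def l'_def)
      have "(\<Sum>f\<in>insert f B \<union> Q'. a f) \<le> (\<Sum>f\<in>B \<union> Q. a f) + (\<Sum>f\<in>(if X = {} then {f0} else X). a f)"
      proof -
        have "insert f B \<union> Q' = (B \<union> Q) \<union> (if X = {} then {f0} else X)"
          using fQ' by (cases "X = {}") (auto simp: Q'_def)
        moreover have "(\<Sum>f\<in>(B \<union> Q) \<inter> (if X = {} then {f0} else X). a f) \<ge> 0"
          using F by (intro sum_nonneg) auto
        moreover have "finite (if X = {} then {f0} else X)" using finX by simp
        ultimately show ?thesis
          using sum_Un[OF finBQ, of "if X = {} then {f0} else X" a] by (simp only:)
      qed
      moreover have "(\<Sum>f\<in>(if X = {} then {f0} else X). a f) \<le> (\<Sum>f\<in>X. a f) + (if X = {} then 2 * R else 0)"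
        using af0 by simp
      moreover have "3 * R * (max 0 (L - l') + w * load a T J' Q' H')
          \<le> 3 * R * max 0 (L - l') + 3 * R * w * (\<Sum>j\<in>J1. M j * indicator {X. X \<inter> (T j \<inter> S) = {}} X)"
      proof -
        have "Q \<union> X \<subseteq> Q'" by (cases "X = {}") (auto simp: Q'_def)
        from loadU[OF this X]
        have "3 * R * w * load a T J' Q' H'
            \<le> 3 * R * w * (\<Sum>j\<in>J1. M j * indicator {X. X \<inter> (T j \<inter> S) = {}} X)"
          using R w by (intro mult_left_mono) auto
        then show ?thesis by (simp add: distrib_left mult.assoc)
      qed
      moreover have "3 * R * max 0 (L - l') + l' * R + (if X = {} then 2 * R else 0)
          \<le> 3 * R * max 0 (L - l) + l * R + e * indicator {X. X \<inter> S = {}} X"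
      proof (cases "X = {}")
        case True
        have "3 * R * (max 0 (L - Suc l) + 1) \<le> 3 * R * max 0 (L - l) + e"
        proof (cases "L - 1 < l")
          case True
          have "3 * R * max 0 (L - Suc l) \<le> 3 * R * max 0 (L - l)" using R by (intro mult_left_mono) auto
          then show ?thesis using True by (simp add: e_def distrib_left)
        qed (use R in \<open>simp add: e_def\<close>)
        then show ?thesis using True by (simp add: l'_def algebra_simps)
      next
        case False
        have "0 \<le> e * indicator {X. X \<inter> S = {}} X" using R by (simp add: e_def)
        then show ?thesis using False by (simp add: l'_def)
      qed
      ultimately show ?thesis
        unfolding out potential_def U_def base_def HH' prod.case by linarith
    qed
    have "measure_pmf.expectation (serve S a y (Q, H, l)) (\<lambda>(f, s). potential F a T R w L J' (insert f B) s)
        \<le> measure_pmf.expectation P U"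
      unfolding serve integral_map_pmf
      using le_U by (intro integral_mono_AE int AE_pmfI)
    also have "\<dots> = base + (\<Sum>f\<in>S. a f * p f)
        + 3 * R * w * (\<Sum>j\<in>J1. M j * measure_pmf.prob P {X. X \<inter> (T j \<inter> S) = {}})
        + e * measure_pmf.prob P {X. X \<inter> S = {}}"
    proof -
      have "measure_pmf.expectation P (\<lambda>X. \<Sum>f\<in>X. a f) = (\<Sum>f\<in>S. a f * p f)"
        unfolding P_def using finS p by (intro expectation_sum_indep_subset) auto
      then show ?thesis
        unfolding U_def by (simp add: int Bochner_Integration.integral_add Bochner_Integration.integral_sum)
    qed
    also have "\<dots> \<le> base + (\<Sum>f\<in>S. a f * \<Delta> f) + 3 * R * w * load a T J' Q H + e * exp (- (\<Sum>f\<in>S. \<Delta> f))"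
    proof -
      have "(\<Sum>f\<in>S. a f * p f) \<le> (\<Sum>f\<in>S. a f * \<Delta> f)"
        using p F S by (intro sum_mono mult_left_mono) auto
      \<comment> \<open>The hazard added inside \<open>T j \<inter> S\<close> cancels exactly
        against the probability that this part stays closed.\<close>
      moreover have "(\<Sum>j\<in>J1. M j * measure_pmf.prob P {X. X \<inter> (T j \<inter> S) = {}}) = load a T J' Q H"
      proof -
        have "M j * measure_pmf.prob P {X. X \<inter> (T j \<inter> S) = {}} = exp (\<Sum>f\<in>T j. H f)" if "j \<in> J1" for j
        proof -
          have "finite (T j)" using that J J1 F by (meson finite_subset subsetD)
          then have "(\<Sum>f\<in>T j. H' f) = (\<Sum>f\<in>T j. H f) + (\<Sum>f\<in>T j \<inter> S. \<Delta> f)"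
            by (simp add: sum.inter_restrict sum.distrib[symmetric])
              (intro sum.cong, auto simp: H'_def \<Delta>_def)
          then show ?thesis unfolding M_def by (simp add: prob exp_add[symmetric])
        qed
        then have "(\<Sum>j\<in>J1. M j * measure_pmf.prob P {X. X \<inter> (T j \<inter> S) = {}}) = (\<Sum>j\<in>J1. exp (\<Sum>f\<in>T j. H f))"
          by (intro sum.cong) auto
        also have "\<dots> = load a T J' Q H"
          unfolding load_def J1_def using J J'J
          by (intro sum.mono_neutral_cong_left) (auto intro: finite_subset)
        finally show ?thesis .
      qed
      ultimately show ?thesis by (simp add: prob)
    qed
    also have "\<dots> \<le> base + (\<Sum>f\<in>S. a f * \<Delta> f) + 3 * R * w * load a T J Q H"
    proof -
      \<comment> \<open>Above the threshold, the new hazard of \<open>S\<close> is \<open>l\<close>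
        times a mass of at least one half, so its exponential weighted by \<open>w\<close> is at
        least 1. Multiplication by the failure probability turns that exponential into the old load
        term of \<open>j0\<close>.\<close>
      have "e * exp (- (\<Sum>f\<in>S. \<Delta> f)) \<le> 3 * R * w * exp (\<Sum>f\<in>S. H f)"
      proof (cases "L - 1 < l")
        case True
        have "1 \<le> w * exp ((L - 1) / 2)" by (rule w)
        also have "(L - 1) / 2 \<le> l * (\<Sum>f\<in>S. y f)"
          using True S(2) mult_left_mono[OF S(2), of "real l"] by simp
        also have "l * (\<Sum>f\<in>S. y f) = (\<Sum>f\<in>S. H f) + (\<Sum>f\<in>S. \<Delta> f)"
          by (simp add: \<Delta>_def sum_distrib_left sum.distrib[symmetric])
        finally have "1 \<le> w * exp ((\<Sum>f\<in>S. H f) + (\<Sum>f\<in>S. \<Delta> f))" using w by (simp add: mult_left_mono)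
        then have "exp (- (\<Sum>f\<in>S. \<Delta> f)) * 1 \<le> exp (- (\<Sum>f\<in>S. \<Delta> f)) * (w * exp ((\<Sum>f\<in>S. H f) + (\<Sum>f\<in>S. \<Delta> f)))"
          by (intro mult_left_mono) auto
        also have "\<dots> = w * exp (\<Sum>f\<in>S. H f)" by (simp add: exp_add exp_minus)
        finally have "3 * R * exp (- (\<Sum>f\<in>S. \<Delta> f)) \<le> 3 * R * (w * exp (\<Sum>f\<in>S. H f))"
          using R by (intro mult_left_mono) auto
        then show ?thesis using True by (simp add: e_def)
      next
        case False
        then show ?thesis using R w by (simp add: e_def)
      qed
      moreover have "load a T J' Q H + exp (\<Sum>f\<in>S. H f) \<le> load a T J Q H"
      proof -
        have "free a Q (T j0)" using False J by (auto simp: free_def)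
        then have "load a T J Q H = exp (\<Sum>f\<in>S. H f) + load a T (J - {j0}) Q H"
          unfolding load_def using J by (subst sum.remove[OF J(1,2)]) simp
        moreover have "load a T J' Q H \<le> load a T (J - {j0}) Q H" using J by (intro load_subset) auto
        ultimately show ?thesis by simp
      qed
      then have "3 * R * w * (load a T J' Q H + exp (\<Sum>f\<in>S. H f)) \<le> 3 * R * w * load a T J Q H"
        using R w by (intro mult_left_mono) auto
      ultimately show ?thesis by (simp add: distrib_left)
    qed
    also have "\<dots> = potential F a T R w L J B (Q, H, l)"
      by (simp add: potential_def base_def algebra_simps)
    finally show ?thesis .
  qed
qed

section \<open>The online algorithm\<close>

definition initial_state :: "'f state" where
  "initial_state = ({}, \<lambda>_. 0, 0)"

text \<open>The guard on \<open>f\<close> keeps the choice admissible for arbitrary pasts, as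
  \<open>online_algorithm\<close> demands; on served runs it always passes.\<close>

definition step :: "('c, 'f, 'f state) hidden_step" where
  "step past r s =
     (let \<phi>s = map (snd \<circ> fst) past; \<phi> = snd r; V0 = snd (fractional \<phi>s);
          V1 = snd (fractional (\<phi>s @ [\<phi>])); y = fst (fractional (\<phi>s @ [\<phi>]))
      in map_pmf (\<lambda>(f, s'). (if f \<in> dom \<phi> then f else SOME f. f \<in> dom \<phi>, s'))
           (serve {f \<in> dom \<phi>. dist_to \<phi> f \<le> radius (scale V1) (length past) (V1 - V0)}
             (open_cost \<phi>) y (if scale V1 = scale V0 then s else initial_state)))"

lemma step_online:
  assumes "dom (snd r) \<noteq> {}" "(f, s') \<in> set_pmf (step past r s)"
  shows "f \<in> dom (snd r)"
proof -
  have "(SOME f. f \<in> dom (snd r)) \<in> dom (snd r)" using assms(1) by (simp add: some_in_eq)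
  then show ?thesis using assms(2) by (auto simp only: step_def Let_def set_map_pmf split: if_splits)
qed

context facility_location
begin

abbreviation Z :: "'c list \<Rightarrow> real" where "Z cs \<equiv> scale (V cs)"
abbreviation n :: nat where "n \<equiv> card (clients I)"

definition near :: "'c list \<Rightarrow> 'c \<Rightarrow> 'f set" where
  "near cs c = {f \<in> reachable c. dist c f \<le> radius (Z (cs @ [c])) (length cs) (\<tau> cs c)}"

definition refresh :: "'c list \<Rightarrow> 'c \<Rightarrow> 'f state \<Rightarrow> 'f state" where
  "refresh cs c s = (if Z (cs @ [c]) = Z cs then s else initial_state)"

text \<open>Indexed by client and exponent, the balls depend only on the super-instance and the
  scale, not on the run. So within a phase the load ranges over a family fixed in advance.\<close>

definition disc :: "real \<Rightarrow> 'c \<times> nat \<Rightarrow> 'f set" where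
  "disc z = (\<lambda>(c, k). {f \<in> F. conn_cost I c f \<le> ennreal (2 * z / 2 ^ k)})"

lemma \<tau>_le:
  assumes "served (cs @ [c])"
  shows "0 \<le> \<tau> cs c" "\<tau> cs c \<le> 2 * Z (cs @ [c])"
proof -
  show "0 \<le> \<tau> cs c" using assms by (auto simp: served_snoc intro: \<tau>_nonneg)
  have "\<tau> cs c \<le> V (cs @ [c])"
    using assms V_nonneg[of cs] by (simp add: served_snoc fractional_snoc)
  then show "\<tau> cs c \<le> 2 * Z (cs @ [c])" using le_2_scale by (rule order_trans)
qed

lemma near_nonempty:
  assumes "served (cs @ [c])"
  shows "1 / 2 \<le> (\<Sum>f\<in>near cs c. y (cs @ [c]) f)" "near cs c \<noteq> {}"
proof -
  have "1 / 2 \<le> (\<Sum>f | f \<in> reachable c \<and> dist c f \<le> \<tau> cs c. y (cs @ [c]) f)"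
    using assms by (intro mass_ball_ge) (simp add: served_snoc)
  also have "\<dots> \<le> (\<Sum>f\<in>near cs c. y (cs @ [c]) f)"
    using finite_reachable y_nonneg radius(2)[OF \<tau>_le[OF assms]]
    by (intro sum_mono2) (auto simp: near_def intro: order_trans)
  finally show "1 / 2 \<le> (\<Sum>f\<in>near cs c. y (cs @ [c]) f)" .
  then show "near cs c \<noteq> {}" by auto
qed

lemma near_subset: "near cs c \<subseteq> reachable c" "near cs c \<subseteq> F" "finite (near cs c)"
  using finite_subset[OF _ finF, of "near cs c"] by (auto simp: near_def reachable)

lemma near_eq_disc:
  assumes "served (cs @ [c])"
  shows "\<exists>k\<le>Suc (length cs). near cs c = disc (Z (cs @ [c])) (c, k)"
proof -
  obtain k where k: "k \<le> Suc (length cs)"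
    "radius (Z (cs @ [c])) (length cs) (\<tau> cs c) = 2 * Z (cs @ [c]) / 2 ^ k"
    using radius(1)[OF \<tau>_le[OF assms]] by blast
  let ?r = "2 * Z (cs @ [c]) / 2 ^ k"
  have "0 \<le> ?r" using scale_nonneg by simp
  then have "conn_cost I c f < \<infinity> \<and> dist c f \<le> ?r \<longleftrightarrow> conn_cost I c f \<le> ennreal ?r" for f
    by (cases "conn_cost I c f") (auto simp: top_unique)
  then have "near cs c = disc (Z (cs @ [c])) (c, k)"
    unfolding near_def disc_def k(2) reachable by auto
  then show ?thesis using k(1) by blast
qed

lemma step_eq_serve:
  assumes "served (map fst h @ [c])"
  shows "step (past_of I h) (request I c) s =
    serve (near (map fst h) c) a (y (map fst h @ [c])) (refresh (map fst h) c s)"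
proof -
  let ?cs = "map fst h"
  have 1: "map (snd \<circ> fst) (past_of I h) = map offer ?cs" by (induction h) auto
  have 2: "fst (fractional (map offer ?cs @ [offer c])) = y (?cs @ [c])"
    "snd (fractional (map offer ?cs @ [offer c])) = V (?cs @ [c])"
    "snd (fractional (map offer ?cs)) = V ?cs" by (simp_all add: y_def V_def)
  have 3: "V (?cs @ [c]) - V ?cs = \<tau> ?cs c" by (simp add: fractional_snoc)
  have 4: "{f \<in> reachable c. dist_to (offer c) f \<le> radius (Z (?cs @ [c])) (length (past_of I h)) (\<tau> ?cs c)}
      = near ?cs c"
    unfolding near_def by (intro Collect_cong conj_cong refl) (simp add: dist_to)
  let ?p = "serve (near ?cs c) (open_cost (offer c)) (y (?cs @ [c])) (refresh ?cs c s)"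
  have "step (past_of I h) (request I c) s =
      map_pmf (\<lambda>(f, s'). (if f \<in> reachable c then f else SOME f. f \<in> reachable c, s')) ?p"
    unfolding step_def Let_def 1 2 3 4 refresh_def by simp
  also have "\<dots> = map_pmf id ?p"
  proof (rule map_pmf_cong[OF refl])
    fix x assume x: "x \<in> set_pmf ?p"
    obtain f Q' H' l' Q H l where xs: "x = (f, Q', H', l')" "refresh ?cs c s = (Q, H, l)"
      by (cases x; cases "refresh ?cs c s") auto
    have "f \<in> near ?cs c"
      using set_pmf_serve[OF near_subset(3) near_nonempty(2)[OF assms] x[unfolded xs]] by blast
    then show "(case x of (f, s') \<Rightarrow> (if f \<in> reachable c then f else SOME f. f \<in> reachable c, s')) = id x"
      using near_subset(1) xs(1) by auto
  qed
  also have "\<dots> = ?p" by (simp add: pmf.map_id)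
  also have "\<dots> = serve (near ?cs c) a (y (?cs @ [c])) (refresh ?cs c s)"
  proof -
    have "serve (near ?cs c) (open_cost (offer c)) (y (?cs @ [c])) = serve (near ?cs c) a (y (?cs @ [c]))"
      using near_subset(1) by (intro serve_cong open_cost) auto
    then show ?thesis by simp
  qed
  finally show ?thesis .
qed

lemma step_in_near:
  assumes "served (map fst h @ [c])" "(f, s') \<in> set_pmf (step (past_of I h) (request I c) s)"
  shows "f \<in> near (map fst h) c"
proof -
  obtain Q' H' l' Q H l where xs: "s' = (Q', H', l')" "refresh (map fst h) c s = (Q, H, l)"
    by (cases s'; cases "refresh (map fst h) c s") auto
  show ?thesis
    using set_pmf_serve[OF near_subset(3) near_nonempty(2)[OF assms(1)]
      assms(2)[unfolded step_eq_serve[OF assms(1)] xs]] by blast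
qed

section \<open>Connection cost on every run\<close>

lemma hidden_run_prefix:
  "h' \<in> set_pmf (hidden_run I st adv N h s) \<Longrightarrow> \<exists>zs. h' = h @ zs"
proof (induction N arbitrary: h s)
  case (Suc N)
  show ?case
  proof (cases "adv h")
    case (Some c)
    then obtain f s' where "h' \<in> set_pmf (hidden_run I st adv N (h @ [(c, f)]) s')"
      using Suc.prems by auto
    then show ?thesis using Suc.IH by fastforce
  qed (use Suc.prems in simp)
qed simp

lemma served_prefix: "served (map fst (h @ zs)) \<Longrightarrow> served (map fst h)"
  by (simp add: served_def)

text \<open>The deficit \<open>2 / 2 ^ length cs\<close> halves with each client; the amount
  \<open>1 / 2 ^ length cs\<close> by which it falls, times \<open>V\<close>, absorbs the additive
  rounding loss.\<close>

definition conn_bound :: "'c list \<Rightarrow> real" where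
  "conn_bound cs = (4 - 2 / 2 ^ length cs) * V cs"

lemma connection_step:
  assumes "served (cs @ [c])" "f \<in> near cs c"
  shows "ennreal (conn_bound cs) + conn_cost I c f \<le> ennreal (conn_bound (cs @ [c]))"
proof -
  let ?V' = "V (cs @ [c])" and ?i = "length cs"
  have V: "0 \<le> V cs" "0 \<le> ?V'" "0 \<le> \<tau> cs c" "?V' = V cs + \<tau> cs c"
    using assms(1) \<tau>_le(1) by (auto simp: served_snoc fractional_snoc intro!: V_nonneg add_nonneg_nonneg)
  have p: "2 / 2 ^ ?i \<le> (2 :: real)" by (simp add: divide_le_eq)
  have "dist c f \<le> radius (Z (cs @ [c])) ?i (\<tau> cs c)" using assms(2) by (simp add: near_def)
  also have "\<dots> \<le> 2 * \<tau> cs c + Z (cs @ [c]) / 2 ^ ?i" by (rule radius(3)[OF \<tau>_le[OF assms(1)]])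
  also have "Z (cs @ [c]) / 2 ^ ?i \<le> ?V' / 2 ^ ?i"
    using scale_le[OF V(2)] by (intro divide_right_mono) auto
  also have "2 * \<tau> cs c \<le> (4 - 2 / 2 ^ ?i) * \<tau> cs c" using V(3) p by (intro mult_right_mono) linarith+
  finally have "conn_bound cs + dist c f \<le> (4 - 2 / 2 ^ ?i) * ?V' + ?V' / 2 ^ ?i"
    unfolding conn_bound_def V(4) by (simp add: distrib_left)
  also have "\<dots> = conn_bound (cs @ [c])" by (simp add: conn_bound_def algebra_simps)
  finally have le: "conn_bound cs + dist c f \<le> conn_bound (cs @ [c])" .
  have "conn_cost I c f < \<infinity>" using assms(2) by (simp add: near_def reachable)
  then obtain r where "conn_cost I c f = ennreal r" "dist c f = r" "0 \<le> r"
    by (cases "conn_cost I c f") auto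
  moreover have "0 \<le> conn_bound cs" unfolding conn_bound_def using V(1) p by (intro mult_nonneg_nonneg) linarith+
  ultimately show ?thesis using le by (simp add: ennreal_plus[symmetric] del: ennreal_plus)
qed

lemma connection_cost_le:
  assumes "h' \<in> set_pmf (hidden_run I step adv N h s)" "served (map fst h')"
    "connection_cost I h \<le> ennreal (conn_bound (map fst h))"
  shows "connection_cost I h' \<le> ennreal (conn_bound (map fst h'))"
  using assms
proof (induction N arbitrary: h s)
  case (Suc N)
  show ?case
  proof (cases "adv h")
    case (Some c)
    then obtain f s' where f: "(f, s') \<in> set_pmf (step (past_of I h) (request I c) s)"
      and h': "h' \<in> set_pmf (hidden_run I step adv N (h @ [(c, f)]) s')"
      using Suc.prems by auto
    have sv: "served (map fst h @ [c])"
      using hidden_run_prefix[OF h'] Suc.prems(2) served_prefix[of "h @ [(c, f)]"] by auto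
    have "connection_cost I (h @ [(c, f)]) = connection_cost I h + conn_cost I c f"
      by (simp add: connection_cost_def)
    also have "\<dots> \<le> ennreal (conn_bound (map fst h)) + conn_cost I c f"
      using Suc.prems(3) by (intro add_right_mono)
    also have "\<dots> \<le> ennreal (conn_bound (map fst h @ [c]))"
      by (rule connection_step[OF sv step_in_near[OF sv f]])
    finally show ?thesis using h' Suc.prems(2) by (intro Suc.IH[OF h']) auto
  qed (use Suc.prems in simp)
qed simp

section \<open>Expected opening cost\<close>

definition threshold :: real where
  "threshold = 1 + 2 * ln (real n * (n + 1))"

text \<open>A fresh phase of scale z needs at most \<open>9 * z * (threshold + 1)\<close> beyond
  costs already paid, and z is at most twice the increase of the scale; hence 18.\<close>

definition budget :: real where
  "budget = 18 * (threshold + 1)"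

text \<open>As no client arrives twice, its balls can be given up on arrival. Exponents are at most
  one plus the number of earlier clients, hence at most \<open>n\<close>.\<close>

definition waiting :: "'c list \<Rightarrow> ('c \<times> nat) set" where
  "waiting cs = (clients I - set cs) \<times> {..n}"

text \<open>At the current scale, \<open>3 * z\<close> bounds the fractional opening cost 3/2 *
  \<open>V\<close>, as \<open>V\<close> is at most \<open>2 * z\<close>. The weight brings the load
  at the start of a phase down to at most 1.\<close>

definition pot :: "real \<Rightarrow> 'c list \<Rightarrow> 'f set \<Rightarrow> 'f state \<Rightarrow> real" where
  "pot z cs B = potential F a (disc z) (3 * z) (1 / (real n * (n + 1))) threshold (waiting cs) B"

text \<open>The bound on \<open>H\<close> makes later hazard increments nonnegative and lets
  \<open>l * R\<close> cover the hazard already charged.\<close>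

definition invar :: "('c, 'f) transcript \<Rightarrow> 'f state \<Rightarrow> bool" where
  "invar h = (\<lambda>(Q, H, l). served (map fst h) \<and> distinct (map fst h) \<and> fst ` set h \<subseteq> clients I \<and>
     snd ` set h \<subseteq> F \<and> Q \<subseteq> F \<and> (\<forall>f\<in>F. H f \<le> l * y (map fst h) f))"

lemma threshold_nonneg: "0 \<le> threshold"
proof (cases "n = 0")
  case False
  then have "1 * 1 \<le> real n * (n + 1)" by (intro mult_mono) auto
  then have "0 \<le> ln (real n * (n + 1))" by (intro ln_ge_zero) simp
  then show ?thesis by (simp add: threshold_def)
qed (simp add: threshold_def)

lemma invar_hazard:
  assumes "invar h (Q, H, l)"
  shows "(\<Sum>f\<in>F. a f * H f) \<le> l * (3 * Z (map fst h))"
proof -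
  have "(\<Sum>f\<in>F. a f * H f) \<le> (\<Sum>f\<in>F. a f * (l * y (map fst h) f))"
    using assms a_nonneg by (intro sum_mono mult_left_mono) (auto simp: invar_def)
  also have "\<dots> = l * (\<Sum>f\<in>F. a f * y (map fst h) f)" by (simp add: sum_distrib_left algebra_simps)
  also have "\<dots> \<le> l * (3 / 2 * V (map fst h))"
    using assms by (intro mult_left_mono fractional_opening_cost) (auto simp: invar_def)
  also have "\<dots> \<le> l * (3 * Z (map fst h))"
    using le_2_scale[of "V (map fst h)"] by (intro mult_left_mono) auto
  finally show ?thesis .
qed

lemma pot_ge:
  assumes "invar h s"
  shows "(\<Sum>f\<in>snd ` set h. a f) \<le> pot (Z (map fst h)) (map fst h) (snd ` set h) s"
proof -
  obtain Q H l where s: "s = (Q, H, l)" by (cases s)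
  show ?thesis
    unfolding pot_def s using assms scale_nonneg finF a_nonneg invar_hazard[of h Q H l]
    by (intro potential_ge) (auto simp: invar_def s)
qed

lemma pot_nonneg:
  assumes "invar h s"
  shows "0 \<le> pot (Z (map fst h)) (map fst h) (snd ` set h) s"
proof -
  have "0 \<le> (\<Sum>f\<in>snd ` set h. a f)"
    using assms a_nonneg by (intro sum_nonneg) (auto simp: invar_def)
  then show ?thesis using pot_ge[OF assms] by linarith
qed

text \<open>
  A new phase restores the full potential; as \<^const>\<open>scale\<close> at least doubles, its increase pays.
\<close>

lemma pot_refresh:
  assumes "invar h s" "served (map fst h @ [c])"
  shows "pot (Z (map fst h @ [c])) (map fst h) (snd ` set h) (refresh (map fst h) c s) + budget * Z (map fst h)
    \<le> pot (Z (map fst h)) (map fst h) (snd ` set h) s + budget * Z (map fst h @ [c])"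
proof (cases "Z (map fst h @ [c]) = Z (map fst h)")
  case True
  then show ?thesis by (simp add: refresh_def)
next
  case False
  let ?z = "Z (map fst h)" and ?z' = "Z (map fst h @ [c])"
  let ?w = "1 / (real n * (n + 1))"
  have jump: "2 * ?z \<le> ?z'"
    using assms(2) False V_mono[of c "map fst h"] by (intro scale_jump) (auto simp: served_snoc)
  have "load a (disc ?z') (waiting (map fst h)) {} (\<lambda>_. 0) \<le> (\<Sum>j\<in>waiting (map fst h). 1)"
    unfolding load_def by (intro sum_mono) auto
  also have "\<dots> = real (card (clients I - set (map fst h))) * (n + 1)"
    by (simp add: waiting_def card_cartesian_product algebra_simps)
  also have "\<dots> \<le> real n * (n + 1)"
    using finC by (intro mult_right_mono of_nat_mono card_mono) auto
  finally have "?w * load a (disc ?z') (waiting (map fst h)) {} (\<lambda>_. 0) \<le> 1"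
    by (cases "n = 0") (auto simp: divide_le_eq_1)
  then have "3 * (3 * ?z') * (max 0 threshold + ?w * load a (disc ?z') (waiting (map fst h)) {} (\<lambda>_. 0))
      \<le> 3 * (3 * ?z') * (threshold + 1)"
    using threshold_nonneg scale_nonneg by (intro mult_left_mono) auto
  then have "pot ?z' (map fst h) (snd ` set h) (refresh (map fst h) c s)
      \<le> (\<Sum>f\<in>snd ` set h. a f) + 9 * ?z' * (threshold + 1)"
    using False by (simp add: pot_def refresh_def initial_state_def potential_def)
  also have "9 * ?z' * (threshold + 1) \<le> budget * (?z' - ?z)"
  proof -
    have "9 * (threshold + 1) * ?z' \<le> 9 * (threshold + 1) * (2 * (?z' - ?z))"
      using jump threshold_nonneg by (intro mult_left_mono) auto
    then show ?thesis by (simp add: budget_def algebra_simps)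
  qed
  finally show ?thesis using pot_ge[OF assms(1)] by (simp add: algebra_simps)
qed

lemma pot_step:
  assumes h: "invar h s" and c: "c \<in> clients I" "c \<notin> fst ` set h" "reachable c \<noteq> {}"
  shows "measure_pmf.expectation (step (past_of I h) (request I c) s)
      (\<lambda>(f, s'). pot (Z (map fst h @ [c])) (map fst h @ [c]) (insert f (snd ` set h)) s') + budget * Z (map fst h)
    \<le> pot (Z (map fst h)) (map fst h) (snd ` set h) s + budget * Z (map fst h @ [c])"
proof -
  let ?cs = "map fst h"
  have sv: "served (?cs @ [c])" using h c by (auto simp: invar_def served_snoc)
  obtain Q H l where r: "refresh ?cs c s = (Q, H, l)" by (cases "refresh ?cs c s")
  have inv: "Q \<subseteq> F" "\<And>f. f \<in> F \<Longrightarrow> H f \<le> l * y (?cs @ [c]) f"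
  proof -
    have *: "real l * y ?cs f \<le> real l * y (?cs @ [c]) f" for l f
      using y_mono by (intro mult_left_mono) auto
    show "Q \<subseteq> F" "\<And>f. f \<in> F \<Longrightarrow> H f \<le> l * y (?cs @ [c]) f"
      using h r by (auto simp: invar_def refresh_def initial_state_def split: if_splits intro: order_trans[OF _ *])
  qed
  have hF: "snd ` set h \<subseteq> F" using h by (auto simp: invar_def)
  have "distinct (c # ?cs)" "set (c # ?cs) \<subseteq> clients I" using h c by (auto simp: invar_def)
  then have len: "Suc (length h) \<le> n"
    using finC card_mono[of "clients I" "set (c # ?cs)"] distinct_card[of "c # ?cs"] by simp
  then have n: "0 < n" by simp
  obtain k where k: "k \<le> Suc (length h)" "near ?cs c = disc (Z (?cs @ [c])) (c, k)"
    using near_eq_disc[OF sv] by auto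
  let ?w = "1 / (real n * (n + 1))"
  have "measure_pmf.expectation (serve (near ?cs c) a (y (?cs @ [c])) (Q, H, l))
      (\<lambda>(f, s'). pot (Z (?cs @ [c])) (?cs @ [c]) (insert f (snd ` set h)) s')
      \<le> pot (Z (?cs @ [c])) ?cs (snd ` set h) (Q, H, l)"
    unfolding pot_def
  proof (rule expectation_serve_potential[OF finF hF inv(1) a_nonneg near_subset(2)
        near_nonempty(1)[OF sv] inv(2) y_nonneg])
    have "(\<Sum>f\<in>F. a f * y (?cs @ [c]) f) \<le> 3 / 2 * V (?cs @ [c])" by (rule fractional_opening_cost[OF sv])
    then show "(\<Sum>f\<in>F. a f * y (?cs @ [c]) f) \<le> 3 * Z (?cs @ [c])"
      using le_2_scale[of "V (?cs @ [c])"] by simp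
    show "finite (waiting ?cs)" using finC by (simp add: waiting_def)
    show "(c, k) \<in> waiting ?cs" using c k len by (auto simp: waiting_def)
    show "waiting (?cs @ [c]) \<subseteq> waiting ?cs - {(c, k)}" by (auto simp: waiting_def)
    show "disc (Z (?cs @ [c])) (c, k) = near ?cs c" by (simp add: k)
    show "disc (Z (?cs @ [c])) j \<subseteq> F" for j by (auto simp: disc_def split: prod.split)
    show "0 \<le> ?w" by simp
    \<comment> \<open>\<open>threshold\<close> is chosen to make this exponential the reciprocal of
      the weight.\<close>
    have "exp ((threshold - 1) / 2) = real n * (n + 1)" using n by (simp add: threshold_def)
    then show "1 \<le> ?w * exp ((threshold - 1) / 2)" using n by simp
  qed
  then show ?thesis
    using pot_refresh[OF h sv] unfolding step_eq_serve[OF sv] r by linarith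
qed

lemma invar_step:
  assumes h: "invar h s" and c: "c \<in> clients I" "c \<notin> fst ` set h" "reachable c \<noteq> {}"
    and f: "(f, s') \<in> set_pmf (step (past_of I h) (request I c) s)"
  shows "invar (h @ [(c, f)]) s'"
proof -
  let ?cs = "map fst h"
  have sv: "served (?cs @ [c])" using h c by (auto simp: invar_def served_snoc)
  obtain Q H l where r: "refresh ?cs c s = (Q, H, l)" by (cases "refresh ?cs c s")
  obtain Q' H' l' where s': "s' = (Q', H', l')" by (cases s')
  have *: "real l * y ?cs f \<le> real l * y (?cs @ [c]) f" for l f
    using y_mono by (intro mult_left_mono) auto
  have inv: "Q \<subseteq> F" "\<And>f. f \<in> F \<Longrightarrow> H f \<le> l * y (?cs @ [c]) f"
    using h r by (auto simp: invar_def refresh_def initial_state_def split: if_splits intro: order_trans[OF _ *])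
  have out: "f \<in> near ?cs c" "Q' \<subseteq> Q \<union> near ?cs c" "l \<le> l'"
    "\<And>f. H' f = H f \<or> H' f = l * y (?cs @ [c]) f"
    using set_pmf_serve[OF near_subset(3) near_nonempty(2)[OF sv]
      f[unfolded step_eq_serve[OF sv] r s']] by blast+
  have "H' f \<le> l' * y (?cs @ [c]) f" if "f \<in> F" for f
  proof -
    have "H' f \<le> l * y (?cs @ [c]) f" using out(4)[of f] inv(2)[OF that] by auto
    also have "\<dots> \<le> l' * y (?cs @ [c]) f" using out(3) y_nonneg by (intro mult_right_mono) auto
    finally show ?thesis .
  qed
  then show ?thesis
    using h c sv out(1,2) inv(1) near_subset(2)[of ?cs c] by (auto simp: invar_def s')
qed

lemma served_if_invar: "invar h s \<Longrightarrow> served (map fst h)"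
  by (cases s) (simp add: invar_def)

text \<open>The infinite value matches \<open>OPT\<close> on unserved transcripts, so no control of
  the opening cost is required there.\<close>

definition final_budget :: "('c, 'f) transcript \<Rightarrow> ennreal" where
  "final_budget h = (if served (map fst h) then ennreal (budget * Z (map fst h)) else \<infinity>)"

text \<open>\<open>pot_step\<close> holds conditionally on every past, so an adaptive adversary
  gains nothing in the induction over the remaining rounds. The budget already granted stands on the
  left to avoid differences of possibly infinite quantities.\<close>

lemma expected_opening_cost:
  assumes adv: "semi_adaptive_adversary I adv" and "invar h s"
  shows "(\<integral>\<^sup>+h'. opening_cost I h' \<partial>measure_pmf (hidden_run I step adv N h s)) + ennreal (budget * Z (map fst h))
    \<le> ennreal (pot (Z (map fst h)) (map fst h) (snd ` set h) s)
      + (\<integral>\<^sup>+h'. final_budget h' \<partial>measure_pmf (hidden_run I step adv N h s))"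
  using assms(2)
proof (induction N arbitrary: h s)
  case stop: 0
  then have "opening_cost I h = ennreal (\<Sum>f\<in>snd ` set h. a f)"
    unfolding opening_cost_def using a_nonneg by (subst sum_ennreal) (auto simp: invar_def)
  then show ?case
    using pot_ge[OF stop] served_if_invar[OF stop]
    by (simp add: final_budget_def add_right_mono ennreal_leI)
next
  case (Suc N)
  show ?case
  proof (cases "adv h")
    case None
    have "opening_cost I h = ennreal (\<Sum>f\<in>snd ` set h. a f)"
      unfolding opening_cost_def using a_nonneg Suc.prems by (subst sum_ennreal) (auto simp: invar_def)
    then show ?thesis
      using pot_ge[OF Suc.prems] served_if_invar[OF Suc.prems] None
      by (simp add: final_budget_def add_right_mono ennreal_leI)
  next
    case (Some c)
    then have c: "c \<in> clients I" "c \<notin> fst ` set h"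
      using adv unfolding semi_adaptive_adversary_def by blast+
    let ?cs = "map fst h"
    show ?thesis
    proof (cases "reachable c = {}")
      case True
      have "(\<integral>\<^sup>+h'. final_budget h' \<partial>measure_pmf (hidden_run I step adv (Suc N) h s)) =
          (\<integral>\<^sup>+h'. \<infinity> \<partial>measure_pmf (hidden_run I step adv (Suc N) h s))"
      proof (intro nn_integral_cong_AE AE_pmfI)
        fix h' assume "h' \<in> set_pmf (hidden_run I step adv (Suc N) h s)"
        then obtain f s' where "h' \<in> set_pmf (hidden_run I step adv N (h @ [(c, f)]) s')"
          using Some by auto
        \<comment> \<open>Every continuation still contains the client without facility, so its
          budget is infinite.\<close>
        from hidden_run_prefix[OF this] obtain zs where "h' = (h @ [(c, f)]) @ zs" ..
        then show "final_budget h' = \<infinity>" using True by (auto simp: final_budget_def served_def)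
      qed
      then show ?thesis by simp
    next
      case False
      define \<nu> where "\<nu> = step (past_of I h) (request I c) s"
      define X where "X = (\<lambda>(f, s'). \<integral>\<^sup>+h'. opening_cost I h' \<partial>measure_pmf (hidden_run I step adv N (h @ [(c, f)]) s'))"
      define Y where "Y = (\<lambda>(f, s'). \<integral>\<^sup>+h'. final_budget h' \<partial>measure_pmf (hidden_run I step adv N (h @ [(c, f)]) s'))"
      define P where "P = (\<lambda>(f, s'). pot (Z (?cs @ [c])) (?cs @ [c]) (insert f (snd ` set h)) s')"
      let ?z = "ennreal (budget * Z ?cs)" and ?z' = "ennreal (budget * Z (?cs @ [c]))"
      have b0: "0 \<le> budget" using threshold_nonneg by (simp add: budget_def)
      have run: "hidden_run I step adv (Suc N) h s = bind_pmf \<nu> (\<lambda>(f, s'). hidden_run I step adv N (h @ [(c, f)]) s')"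
        by (simp add: Some \<nu>_def)
      have sv: "served (?cs @ [c])" using Suc.prems False by (auto simp: invar_def served_snoc)
      have fin: "finite (set_pmf \<nu>)"
        unfolding \<nu>_def step_eq_serve[OF sv] by (intro finite_set_pmf_serve near_subset)
      have inv: "invar (h @ [(c, f)]) s'" if "(f, s') \<in> set_pmf \<nu>" for f s'
        by (rule invar_step[OF Suc.prems c False that[unfolded \<nu>_def]])
      have P0: "0 \<le> P x" if "x \<in> set_pmf \<nu>" for x
      proof -
        obtain f s' where x: "x = (f, s')" by (cases x)
        show ?thesis using pot_nonneg[OF inv[OF that[unfolded x]]] by (simp add: P_def x)
      qed
      have "(\<integral>\<^sup>+x. X x \<partial>measure_pmf \<nu>) + ?z' = (\<integral>\<^sup>+x. X x + ?z' \<partial>measure_pmf \<nu>)"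
        by (simp add: nn_integral_add)
      also have "\<dots> \<le> (\<integral>\<^sup>+x. ennreal (P x) + Y x \<partial>measure_pmf \<nu>)"
      proof (intro nn_integral_mono_AE AE_pmfI)
        fix x assume x: "x \<in> set_pmf \<nu>"
        obtain f s' where fs: "x = (f, s')" by (cases x)
        show "X x + ?z' \<le> ennreal (P x) + Y x"
          using Suc.IH[OF inv[OF x[unfolded fs]]] by (simp add: X_def Y_def P_def fs)
      qed
      also have "\<dots> = ennreal (measure_pmf.expectation \<nu> P) + (\<integral>\<^sup>+x. Y x \<partial>measure_pmf \<nu>)"
      proof -
        have "(\<integral>\<^sup>+x. ennreal (P x) \<partial>measure_pmf \<nu>) = ennreal (measure_pmf.expectation \<nu> P)"
          using P0 by (intro nn_integral_eq_integral integrable_measure_pmf_finite fin AE_pmfI)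
        then show ?thesis by (simp add: nn_integral_add)
      qed
      finally have 1: "(\<integral>\<^sup>+x. X x \<partial>measure_pmf \<nu>) + ?z' \<le> ennreal (measure_pmf.expectation \<nu> P) + (\<integral>\<^sup>+x. Y x \<partial>measure_pmf \<nu>)" .
      have E0: "0 \<le> measure_pmf.expectation \<nu> P"
        using P0 by (intro integral_nonneg_AE) (auto simp: AE_measure_pmf_iff)
      have "measure_pmf.expectation \<nu> P + budget * Z ?cs \<le> pot (Z ?cs) ?cs (snd ` set h) s + budget * Z (?cs @ [c])"
        unfolding P_def \<nu>_def by (rule pot_step[OF Suc.prems c False])
      then have "ennreal (measure_pmf.expectation \<nu> P + budget * Z ?cs)
          \<le> ennreal (pot (Z ?cs) ?cs (snd ` set h) s + budget * Z (?cs @ [c]))"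
        by (rule ennreal_leI)
      then have 2: "ennreal (measure_pmf.expectation \<nu> P) + ?z \<le> ennreal (pot (Z ?cs) ?cs (snd ` set h) s) + ?z'"
        using E0 b0 scale_nonneg pot_nonneg[OF Suc.prems] by (simp add: ennreal_plus)
      have "?z' + ((\<integral>\<^sup>+x. X x \<partial>measure_pmf \<nu>) + ?z) = ((\<integral>\<^sup>+x. X x \<partial>measure_pmf \<nu>) + ?z') + ?z"
        by (simp add: ac_simps)
      also have "\<dots> \<le> (ennreal (measure_pmf.expectation \<nu> P) + (\<integral>\<^sup>+x. Y x \<partial>measure_pmf \<nu>)) + ?z"
        by (intro add_right_mono 1)
      also have "\<dots> = (ennreal (measure_pmf.expectation \<nu> P) + ?z) + (\<integral>\<^sup>+x. Y x \<partial>measure_pmf \<nu>)"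
        by (simp add: ac_simps)
      also have "\<dots> \<le> (ennreal (pot (Z ?cs) ?cs (snd ` set h) s) + ?z') + (\<integral>\<^sup>+x. Y x \<partial>measure_pmf \<nu>)"
        by (intro add_right_mono 2)
      also have "\<dots> = ?z' + (ennreal (pot (Z ?cs) ?cs (snd ` set h) s) + (\<integral>\<^sup>+x. Y x \<partial>measure_pmf \<nu>))"
        by (simp add: ac_simps)
      finally have "(\<integral>\<^sup>+x. X x \<partial>measure_pmf \<nu>) + ?z
          \<le> ennreal (pot (Z ?cs) ?cs (snd ` set h) s) + (\<integral>\<^sup>+x. Y x \<partial>measure_pmf \<nu>)"
        by (simp only: ennreal_add_left_cancel_le) simp
      then show ?thesis
        unfolding run nn_integral_bind_pmf X_def Y_def by (simp add: case_prod_beta')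
    qed
  qed
qed

end

section \<open>Logarithms, constants and the final bounds\<close>

lemma ln_le_log1: "1 \<le> m \<Longrightarrow> ln (real m) \<le> log1 m"
proof -
  assume m: "1 \<le> m"
  have "ln 2 * log 2 (real m) \<le> 1 * log 2 (real m)"
    using m ln_2_less_1 by (intro mult_right_mono) auto
  then have "ln (real m) \<le> log 2 (real m)" by (simp add: log_def)
  then show ?thesis by (simp add: log1_def)
qed

lemma log1_ge_1: "1 \<le> log1 m"
  by (simp add: log1_def)

lemma ln_Suc_le: "ln (real m + 1) \<le> 2 * log1 m"
proof (cases "m = 0")
  case False
  then have "ln (real m + 1) \<le> ln (2 * real m)" by (intro ln_mono) auto
  also have "\<dots> = ln 2 + ln (real m)" using False by (simp add: ln_mult)
  finally show ?thesis using ln_le_log1[of m] log1_ge_1[of m] ln_2_less_1 False by linarith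
next
  case True
  then show ?thesis using log1_ge_1[of m] by simp
qed

context facility_location
begin

text \<open>\<open>threshold \<le> 1 + 6 * log1 n\<close> and \<open>1 \<le> log1 n\<close> give the
  factor 18 * 8 = 144.\<close>

lemma budget_le: "budget \<le> 144 * log1 n"
proof (cases "n = 0")
  case False
  then have "threshold = 1 + 2 * (ln (real n) + ln (real n + 1))"
    by (simp add: threshold_def ln_mult add.commute)
  also have "\<dots> \<le> 1 + 2 * (log1 n + 2 * log1 n)"
    using False by (intro add_left_mono mult_left_mono add_mono ln_le_log1 ln_Suc_le) auto
  finally have "threshold \<le> 1 + 6 * log1 n" by simp
  then show ?thesis using log1_ge_1[of n] by (simp add: budget_def)
next
  case True
  then show ?thesis using log1_ge_1[of n] by (simp add: budget_def threshold_def)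
qed

lemma V_le_log1_OPT: "served cs \<Longrightarrow> ennreal (V cs) \<le> ennreal (3 * log1 (card F)) * OPT I cs"
proof -
  assume "served cs"
  note V_le_OPT[OF this]
  also have "ennreal (1 + ln (real (card F) + 1)) * OPT I cs \<le> ennreal (3 * log1 (card F)) * OPT I cs"
    using ln_Suc_le[of "card F"] log1_ge_1[of "card F"] by (intro mult_right_mono ennreal_leI) auto
  finally show ?thesis .
qed

text \<open>For unserved transcripts \<open>OPT\<close> is infinite, and a positive factor keeps the
  product infinite, whereas a factor 0 would give 0.\<close>

lemma bound_by_OPT:
  assumes "0 < K" "served (map fst h) \<Longrightarrow> X \<le> ennreal (K * V (map fst h))"
  shows "X \<le> ennreal (K * (3 * log1 (card F))) * OPT I (map fst h)"
proof (cases "served (map fst h)")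
  case True
  have "X \<le> ennreal K * ennreal (V (map fst h))"
    using assms True V_nonneg[OF True] by (simp add: ennreal_mult)
  also have "\<dots> \<le> ennreal K * (ennreal (3 * log1 (card F)) * OPT I (map fst h))"
    by (intro mult_left_mono V_le_log1_OPT True) auto
  finally show ?thesis
    using assms(1) log1_ge_1[of "card F"] by (simp add: ennreal_mult mult.assoc)
next
  case False
  have "K \<noteq> 0" "log1 (card F) \<noteq> 0" using assms(1) log1_ge_1[of "card F"] by auto
  moreover have "0 < K * (3 * log1 (card F))" using assms(1) log1_ge_1[of "card F"] by simp
  ultimately show ?thesis by (simp add: OPT_not_served[OF False] ennreal_mult_top)
qed

abbreviation alg :: "('c, 'f) algorithm" where "alg \<equiv> behavioural step initial_state"

lemma E_conn_ALG_le:
  "E_conn_ALG I alg adv \<le> ennreal (12 * log1 (card F)) * E_OPT I alg adv"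
proof -
  let ?M = "hidden_run I step adv n [] initial_state"
  have "(\<integral>\<^sup>+h. connection_cost I h \<partial>measure_pmf ?M)
      \<le> (\<integral>\<^sup>+h. ennreal (4 * (3 * log1 (card F))) * OPT I (map fst h) \<partial>measure_pmf ?M)"
  proof (intro nn_integral_mono_AE AE_pmfI bound_by_OPT)
    fix h assume "h \<in> set_pmf ?M" and sv: "served (map fst h)"
    then have "connection_cost I h \<le> ennreal (conn_bound (map fst h))"
      by (rule connection_cost_le) (simp add: connection_cost_def)
    also have "conn_bound (map fst h) \<le> 4 * V (map fst h)"
      unfolding conn_bound_def using V_nonneg[OF sv] by (intro mult_right_mono) auto
    finally show "connection_cost I h \<le> ennreal (4 * V (map fst h))" by (simp add: ennreal_leI)
  qed simp
  then show ?thesis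
    by (simp add: E_conn_ALG_def E_OPT_def play_behavioural nn_integral_cmult)
qed

lemma E_opening_le:
  assumes "semi_adaptive_adversary I adv"
  shows "(\<integral>\<^sup>+h. opening_cost I h \<partial>measure_pmf (play I alg adv))
    \<le> ennreal (432 * (log1 n * log1 (card F))) * E_OPT I alg adv"
proof -
  let ?M = "hidden_run I step adv n [] initial_state"
  have "invar [] initial_state"
    by (simp add: invar_def initial_state_def served_def y_nonneg)
  from expected_opening_cost[OF assms this, of n]
  have "(\<integral>\<^sup>+h. opening_cost I h \<partial>measure_pmf ?M) \<le> (\<integral>\<^sup>+h. final_budget h \<partial>measure_pmf ?M)"
    \<comment> \<open>The empty transcript has scale 0, so its potential and its budget both
      vanish.\<close>
    by (simp add: pot_def potential_def initial_state_def scale_def fractional_Nil)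
  also have "\<dots> \<le> (\<integral>\<^sup>+h. ennreal ((144 * log1 n) * (3 * log1 (card F))) * OPT I (map fst h) \<partial>measure_pmf ?M)"
  proof (intro nn_integral_mono bound_by_OPT)
    fix h :: "('c, 'f) transcript" assume sv: "served (map fst h)"
    have "budget * Z (map fst h) \<le> (144 * log1 n) * V (map fst h)"
      using budget_le scale_le[OF V_nonneg[OF sv]] scale_nonneg log1_ge_1[of n]
      by (intro mult_mono) auto
    then show "final_budget h \<le> ennreal ((144 * log1 n) * V (map fst h))"
      by (simp add: final_budget_def sv ennreal_leI)
  qed (use log1_ge_1[of n] in simp)
  finally show ?thesis
    by (simp add: E_OPT_def play_behavioural nn_integral_cmult mult.assoc)
qed

text \<open>444 is the sum of 4 * 3 for connections and 144 * 3 for openings;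
  \<open>1 \<le> log1 n\<close> absorbs the former into the product.\<close>

lemma E_ALG_le:
  assumes "semi_adaptive_adversary I adv"
  shows "E_ALG I alg adv \<le> ennreal (444 * (log1 n * log1 (card F))) * E_OPT I alg adv"
proof -
  let ?p = "log1 n * log1 (card F)"
  have p: "log1 (card F) \<le> ?p" "0 \<le> ?p"
    using mult_right_mono[OF log1_ge_1[of n], of "log1 (card F)"] log1_ge_1[of "card F"] by auto
  have "E_ALG I alg adv = E_conn_ALG I alg adv + (\<integral>\<^sup>+h. opening_cost I h \<partial>measure_pmf (play I alg adv))"
    unfolding E_ALG_def E_conn_ALG_def total_cost_def by (simp add: nn_integral_add)
  also have "\<dots> \<le> ennreal (12 * ?p) * E_OPT I alg adv + ennreal (432 * ?p) * E_OPT I alg adv"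
  proof (intro add_mono E_opening_le[OF assms] order_trans[OF E_conn_ALG_le])
    show "ennreal (12 * log1 (card F)) * E_OPT I alg adv \<le> ennreal (12 * ?p) * E_OPT I alg adv"
      using p by (intro mult_right_mono ennreal_leI) auto
  qed
  also have "\<dots> = ennreal (12 * ?p + 432 * ?p) * E_OPT I alg adv"
    using p by (subst ennreal_plus) (auto simp only: distrib_right intro: mult_nonneg_nonneg)
  finally show ?thesis by simp
qed

end

theorem theorem3:
  "\<exists>(A :: ('c, 'f) algorithm) (K :: real).
     online_algorithm A \<and> K > 0 \<and>
     (\<forall>(I :: ('c, 'f) instance_data) (adv :: ('c, 'f) adversary).
        super_instance I \<and> semi_adaptive_adversary I adv \<longrightarrow>
          E_ALG I A adv
            \<le> ennreal (K * (log1 (card (clients I)) * log1 (card (facilities I)))) * E_OPT I A adv \<and>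
          E_conn_ALG I A adv
            \<le> ennreal (K * log1 (card (facilities I))) * E_OPT I A adv)"
proof (intro exI[of _ "behavioural step initial_state"] exI[of _ 444] conjI allI impI)
  show "online_algorithm (behavioural step initial_state :: ('c, 'f) algorithm)"
    using step_online by (rule online_behavioural)
next
  fix I :: "('c, 'f) instance_data" and adv
  assume I: "super_instance I \<and> semi_adaptive_adversary I adv"
  then interpret facility_location I by unfold_locales simp
  show "E_ALG I alg adv \<le> ennreal (444 * (log1 n * log1 (card F))) * E_OPT I alg adv"
    using I by (intro E_ALG_le) simp
  have "E_conn_ALG I alg adv \<le> ennreal (12 * log1 (card F)) * E_OPT I alg adv"
    by (rule E_conn_ALG_le)
  also have "\<dots> \<le> ennreal (444 * log1 (card F)) * E_OPT I alg adv"
    using log1_ge_1[of "card F"] by (intro mult_right_mono ennreal_leI) auto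
  finally show "E_conn_ALG I alg adv \<le> ennreal (444 * log1 (card F)) * E_OPT I alg adv" .
qed simp

end
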